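(* Consider the following uplink system. A base station (BS) with $M$ antennas serves $K$ single-antenna user equipments (UEs) at SNR $\rho>0$. The channel matrix is $H=[h_1,\ldots,h_K]\in\mathbb{C}^{M\times K}$, where $h_1,\ldots,h_K$ are independent and $h_k\sim\mathcal{CN}(0_M,C_{h_k})$ with Hermitian positive semidefinite covariance $C_{h_k}\in\mathbb{C}^{M\times M}$. Let $h=\mathrm{vec}(H)$ and $C_h=\mathrm{blkdiag}(C_{h_1},\ldots,C_{h_K})$. Define the 1-bit quantizer, applied entrywise to a complex array $X$, by $$Q(X)=\sqrt{\tfrac{\rho K+1}{2}}\big(\mathrm{sgn}(\Re[X])+j\,\mathrm{sgn}(\Im[X])\big).$$ Channel estimation: let $P=[p_1,\ldots,p_K]\in\mathbb{C}^{\tau\times K}$, $\tau\ge K$, be a pilot matrix with mutually orthogonal columns and entries $P_{u,k}$ satisfying $|P_{u,k}|=1$ for all $u,k$. The BS receives $Y_p=\sqrt{\rho}\,HP^{\mathrm H}+Z_p\in\mathbb{C}^{M\times\tau}$, with $Z_p$ having i.i.d. $\mathcal{CN}(0,1)$ entries, and with $\bar P=P\otimes I_M$ we have $y_p=\mathrm{vec}(Y_p)=\sqrt{\rho}\,\bar P^{*}h+z_p$, $z_p=\mathrm{vec}(Z_p)$. It observes $r_p=Q(y_p)\in\mathbb{C}^{M\tau}$. Let $C_{y_p}=\rho\bar P^{*}C_h\bar P^{\mathrm T}+I_{M\tau}$, $A_p=\sqrt{\tfrac{2}{\pi}(\rho K+1)}\,\mathrm{diag}(C_{y_p})^{-1/2}$,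 $C_{r_p}=\mathbb{E}[r_pr_p^{\mathrm H}]$ (assumed invertible), $\bar P_k=p_k\otimes I_M$, and define the Bussgang LMMSE channel estimate of UE $k$ as $\hat h_k=\sqrt{\rho}\,C_{h_k}\bar P_k^{\mathrm T}A_pC_{r_p}^{-1}r_p\in\mathbb{C}^M$. Data transmission: for a fixed (deterministic) data symbol vector $x=[x_1,\ldots,x_K]^{\mathrm T}\in\mathbb{C}^K$, the BS receives $y=\sqrt{\rho}\,Hx+z$ with $z\sim\mathcal{CN}(0_M,I_M)$, and observes $r=Q(y)$. Here $H$, $z$, $z_p$ are mutually independent. The MRC soft-estimated symbol of UE $k$ is $\hat x_k^{(\mathrm{MRC})}=\hat h_k^{\mathrm H}r$. Define $\Omega(t)=\frac{2}{\pi}\arcsin(t)$ and, for $m,n\in\{1,\ldots,M\}$, $u,v\in\{1,\ldots,\tau\}$, $$\alpha_m=\Big[\rho\sum_{k=1}^K C_{h_k}+I_M\Big]_{m,m},\quad \beta_m=\Big[\rho\sum_{k=1}^K C_{h_k}|x_k|^2+I_M\Big]_{m,m},$$ $$\zeta_{m,n,u,v}=\frac{\rho}{\sqrt{\alpha_m\alpha_n}}\Big[\sum_{k=1}^K C_{h_k}^{\mathrm T}P_{u,k}P_{v,k}^{*}\Big]_{m,n},\qquad \eta_{m,n,u}=\frac{\rho}{\sqrt{\alpha_n\beta_m}}\Big[\sum_{k=1}^K C_{h_k}x_kP_{u,k}\Big]_{m,n}.$$ Then the expected value $\mathsf{E}_k^{(\mathrm{MRC})}=\mathbb{E}_{H,z,z_p}[\hat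 x_k^{(\mathrm{MRC})}]$ is $$\mathsf{E}_k^{(\mathrm{MRC})}=\sqrt{\rho}\,\mathrm{tr}\big(C_{r_p}^{-1}A_p\bar P_k^{*}C_{h_k}C_{rr_p}\big),$$ where $C_{rr_p}=\mathbb{E}[r\,r_p^{\mathrm H}]\in\mathbb{C}^{M\times M\tau}$, and $$[C_{r_p}]_{(u-1)M+m,(v-1)M+n}=\begin{cases}\rho K+1,& m=n\text{ and }u=v,\\ (\rho K+1)\big(\Omega(\Re[\zeta_{m,n,u,v}])-j\,\Omega(\Im[\zeta_{m,n,u,v}])\big),&\text{otherwise},\end{cases}$$ $$[C_{rr_p}]_{m,(u-1)M+n}=(\rho K+1)\big(\Omega(\Re[\eta_{m,n,u}])+j\,\Omega(\Im[\eta_{m,n,u}])\big).$$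
   Context: $\mathrm{vec}$ stacks columns, so entry $(u-1)M+m$ of $y_p$ (or $r_p$) corresponds to antenna $m$ and pilot time $u$. $(\cdot)^{\mathrm T},(\cdot)^{\mathrm H},(\cdot)^*$ denote transpose, conjugate transpose, conjugate; $\otimes$ is the Kronecker product; $\mathrm{diag}(C)$ is the diagonal matrix with the diagonal entries of $C$; $\mathrm{sgn}$ is the sign function applied entrywise. $\mathcal{CN}(0,\Sigma)$ denotes a circularly-symmetric complex Gaussian distribution. *)

theory Defs
  imports "HOL-Probability.Probability"
begin

text \<open>Matrices are HOL-Analysis cartesian matrices: A :: complex^'c^'r has rows indexed by 'r
and columns by 'c (entry A $ row $ col). Dimensions M, K, tau are the cardinalities of the
finite index types 'm (antennas), 'k (UEs), 't (pilot times). The vectorized index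
(u-1)M+m is represented by the pair (u,m) :: 't \<times> 'm (outer index first).\<close>

definition mconj :: "complex^'c::finite^'r::finite \<Rightarrow> complex^'c^'r" where
  "mconj A = (\<chi> i j. cnj (A $ i $ j))"

definition ctrans :: "complex^'c::finite^'r::finite \<Rightarrow> complex^'r^'c" where
  "ctrans A = transpose (mconj A)"

definition kron :: "complex^'c::finite^'r::finite \<Rightarrow> complex^'d::finite^'s::finite \<Rightarrow> complex^('c \<times> 'd)^('r \<times> 's)" where
  "kron A B = (\<chi> i j. A $ fst i $ fst j * B $ snd i $ snd j)"

definition vecm :: "complex^'c::finite^'r::finite \<Rightarrow> complex^('c \<times> 'r)" where
  "vecm X = (\<chi> i. X $ snd i $ fst i)"

definition blkdiag :: "('k::finite \<Rightarrow> complex^'m::finite^'m) \<Rightarrow> complex^('k \<times> 'm)^('k \<times> 'm)" where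
  "blkdiag C = (\<chi> i j. if fst i = fst j then C (fst i) $ snd i $ snd j else 0)"

definition diagm :: "complex^'n::finite^'n \<Rightarrow> complex^'n^'n" where
  "diagm C = (\<chi> i j. if i = j then C $ i $ i else 0)"

definition column_of :: "'k::finite \<Rightarrow> complex^'k^'m::finite \<Rightarrow> complex^'m" where
  "column_of k H = (\<chi> m. H $ m $ k)"

definition hermitian :: "complex^'n::finite^'n \<Rightarrow> bool" where
  "hermitian C \<longleftrightarrow> (\<forall>i j. C $ i $ j = cnj (C $ j $ i))"

definition psd :: "complex^'n::finite^'n \<Rightarrow> bool" where
  "psd C \<longleftrightarrow> hermitian C \<and>
     (\<forall>v::complex^'n. 0 \<le> Re (\<Sum>i\<in>UNIV. \<Sum>j\<in>UNIV. cnj (v $ i) * C $ i $ j * v $ j))"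

text \<open>Circularly-symmetric complex Gaussian vector CN(0,C), via its characteristic function
  E[exp(j Re(t^H X))] = exp(-t^H C t / 4).\<close>
definition cgauss :: "'w measure \<Rightarrow> ('w \<Rightarrow> complex^'n::finite) \<Rightarrow> complex^'n^'n \<Rightarrow> bool" where
  "cgauss Mw X C \<longleftrightarrow> X \<in> borel_measurable Mw \<and>
     (\<forall>t::complex^'n. (\<integral>\<omega>. cis (Re (\<Sum>i\<in>UNIV. cnj (t $ i) * X \<omega> $ i)) \<partial>Mw)
        = exp (- (\<Sum>i\<in>UNIV. \<Sum>j\<in>UNIV. cnj (t $ i) * C $ i $ j * t $ j) / 4))"

definition cgauss1 :: "'w measure \<Rightarrow> ('w \<Rightarrow> complex) \<Rightarrow> real \<Rightarrow> bool" where
  "cgauss1 Mw X s2 \<longleftrightarrow> X \<in> borel_measurable Mw \<and>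
     (\<forall>t::complex. (\<integral>\<omega>. cis (Re (cnj t * X \<omega>)) \<partial>Mw) = exp (- (s2 * (cmod t)\<^sup>2) / 4))"

definition quant :: "real \<Rightarrow> nat \<Rightarrow> complex \<Rightarrow> complex" where
  "quant \<rho> K c = complex_of_real (sqrt ((\<rho> * real K + 1) / 2)) *
     (complex_of_real (sgn (Re c)) + \<i> * complex_of_real (sgn (Im c)))"

definition Omega :: "real \<Rightarrow> real" where
  "Omega t = 2 / pi * arcsin t"

definition Pbar :: "complex^'k::finite^'t::finite \<Rightarrow> complex^('k \<times> 'm::finite)^('t \<times> 'm)" where
  "Pbar P = kron P (mat 1)"

definition Pbark :: "complex^'k::finite^'t::finite \<Rightarrow> 'k \<Rightarrow> complex^'m::finite^('t \<times> 'm)" where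
  "Pbark P k = (\<chi> i n. P $ fst i $ k * (if snd i = n then 1 else 0))"

definition Cyp :: "real \<Rightarrow> complex^'k::finite^'t::finite \<Rightarrow> ('k \<Rightarrow> complex^'m::finite^'m) \<Rightarrow> complex^('t \<times> 'm)^('t \<times> 'm)" where
  "Cyp \<rho> P C = \<rho> *\<^sub>R (mconj (Pbar P) ** blkdiag C ** transpose (Pbar P)) + mat 1"

text \<open>A_p = sqrt(2/pi (rho K+1)) diag(C_yp)^(-1/2); the diagonal of C_yp is real and positive.\<close>
definition Ap :: "real \<Rightarrow> complex^'k::finite^'t::finite \<Rightarrow> ('k \<Rightarrow> complex^'m::finite^'m) \<Rightarrow> complex^('t \<times> 'm)^('t \<times> 'm)" where
  "Ap \<rho> P C = (\<chi> i j. if i = j then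
      complex_of_real (sqrt (2 / pi * (\<rho> * real CARD('k) + 1)) / sqrt (Re (Cyp \<rho> P C $ i $ i)))
      else 0)"

definition alpha :: "real \<Rightarrow> ('k::finite \<Rightarrow> complex^'m::finite^'m) \<Rightarrow> 'm \<Rightarrow> complex" where
  "alpha \<rho> C m = (\<rho> *\<^sub>R (\<Sum>k\<in>UNIV. C k) + mat 1) $ m $ m"

definition beta :: "real \<Rightarrow> ('k::finite \<Rightarrow> complex^'m::finite^'m) \<Rightarrow> complex^'k::finite \<Rightarrow> 'm \<Rightarrow> complex" where
  "beta \<rho> C x m = (\<rho> *\<^sub>R (\<Sum>k\<in>UNIV. (cmod (x $ k))\<^sup>2 *\<^sub>R C k) + mat 1) $ m $ m"

definition zeta :: "real \<Rightarrow> ('k::finite \<Rightarrow> complex^'m::finite^'m) \<Rightarrow> complex^'k::finite^'t::finite \<Rightarrow> 'm \<Rightarrow> 'm \<Rightarrow> 't \<Rightarrow> 't \<Rightarrow> complex" where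
  "zeta \<rho> C P m n u v = complex_of_real \<rho> / csqrt (alpha \<rho> C m * alpha \<rho> C n) *
     (\<Sum>k\<in>UNIV. transpose (C k) $ m $ n * P $ u $ k * cnj (P $ v $ k))"

definition eta :: "real \<Rightarrow> ('k::finite \<Rightarrow> complex^'m::finite^'m) \<Rightarrow> complex^'k::finite^'t::finite \<Rightarrow> complex^'k \<Rightarrow> 'm \<Rightarrow> 'm \<Rightarrow> 't \<Rightarrow> complex" where
  "eta \<rho> C P x m n u = complex_of_real \<rho> / csqrt (alpha \<rho> C n * beta \<rho> C x m) *
     (\<Sum>k\<in>UNIV. C k $ m $ n * x $ k * P $ u $ k)"

definition yp :: "real \<Rightarrow> complex^'k::finite^'t::finite \<Rightarrow> complex^'k^'m::finite \<Rightarrow> complex^'t^'m \<Rightarrow> complex^('t \<times> 'm)" where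
  "yp \<rho> P Hm Zpm = sqrt \<rho> *\<^sub>R (mconj (Pbar P) *v vecm Hm) + vecm Zpm"

definition rp :: "real \<Rightarrow> complex^'k::finite^'t::finite \<Rightarrow> complex^'k^'m::finite \<Rightarrow> complex^'t^'m \<Rightarrow> complex^('t \<times> 'm)" where
  "rp \<rho> P Hm Zpm = (\<chi> i. quant \<rho> CARD('k) (yp \<rho> P Hm Zpm $ i))"

definition rdata :: "real \<Rightarrow> complex^'k::finite^'m::finite \<Rightarrow> complex^'m \<Rightarrow> complex^'k \<Rightarrow> complex^'m" where
  "rdata \<rho> Hm zv x = (\<chi> m. quant \<rho> CARD('k) ((sqrt \<rho> *\<^sub>R (Hm *v x) + zv) $ m))"

definition mutually_indep :: "'w measure \<Rightarrow> ('k::finite \<Rightarrow> 'w \<Rightarrow> complex^'m::finite)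
    \<Rightarrow> ('w \<Rightarrow> complex^'t::finite^'m) \<Rightarrow> ('w \<Rightarrow> complex^'m) \<Rightarrow> bool" where
  "mutually_indep Mw h Zp z \<longleftrightarrow> prob_space.indep_sets Mw
     (\<lambda>i. case i of
        Some (Some k) \<Rightarrow> {h k -` A \<inter> space Mw | A. A \<in> sets borel}
      | Some None \<Rightarrow> {Zp -` A \<inter> space Mw | A. A \<in> sets borel}
      | None \<Rightarrow> {z -` A \<inter> space Mw | A. A \<in> sets borel}) UNIV"

definition Crp_of :: "'w measure \<Rightarrow> real \<Rightarrow> complex^'k::finite^'t::finite \<Rightarrow> ('w \<Rightarrow> complex^'k^'m::finite)
    \<Rightarrow> ('w \<Rightarrow> complex^'t^'m) \<Rightarrow> complex^('t \<times> 'm)^('t \<times> 'm)" where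
  "Crp_of Mw \<rho> P H Zp =
     (\<chi> i j. \<integral>\<omega>. rp \<rho> P (H \<omega>) (Zp \<omega>) $ i * cnj (rp \<rho> P (H \<omega>) (Zp \<omega>) $ j) \<partial>Mw)"

definition Crrp_of :: "'w measure \<Rightarrow> real \<Rightarrow> complex^'k::finite^'t::finite \<Rightarrow> complex^'k
    \<Rightarrow> ('w \<Rightarrow> complex^'k^'m::finite) \<Rightarrow> ('w \<Rightarrow> complex^'t^'m) \<Rightarrow> ('w \<Rightarrow> complex^'m)
    \<Rightarrow> complex^('t \<times> 'm)^'m" where
  "Crrp_of Mw \<rho> P x H Zp z =
     (\<chi> m j. \<integral>\<omega>. rdata \<rho> (H \<omega>) (z \<omega>) x $ m * cnj (rp \<rho> P (H \<omega>) (Zp \<omega>) $ j) \<partial>Mw)"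

definition hhat :: "'w measure \<Rightarrow> real \<Rightarrow> complex^'k::finite^'t::finite \<Rightarrow> ('k \<Rightarrow> complex^'m::finite^'m)
    \<Rightarrow> ('w \<Rightarrow> complex^'k^'m) \<Rightarrow> ('w \<Rightarrow> complex^'t^'m) \<Rightarrow> 'k \<Rightarrow> 'w \<Rightarrow> complex^'m" where
  "hhat Mw \<rho> P C H Zp k \<omega> = sqrt \<rho> *\<^sub>R
     ((C k ** transpose (Pbark P k) ** Ap \<rho> P C ** matrix_inv (Crp_of Mw \<rho> P H Zp))
        *v rp \<rho> P (H \<omega>) (Zp \<omega>))"

definition EMRC :: "'w measure \<Rightarrow> real \<Rightarrow> complex^'k::finite^'t::finite \<Rightarrow> ('k \<Rightarrow> complex^'m::finite^'m)
    \<Rightarrow> complex^'k \<Rightarrow> ('w \<Rightarrow> complex^'k^'m) \<Rightarrow> ('w \<Rightarrow> complex^'t^'m) \<Rightarrow> ('w \<Rightarrow> complex^'m) \<Rightarrow> 'k \<Rightarrow> complex" where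
  "EMRC Mw \<rho> P C x H Zp z k =
     (\<integral>\<omega>. (\<Sum>m\<in>UNIV. cnj (hhat Mw \<rho> P C H Zp k \<omega> $ m) * rdata \<rho> (H \<omega>) (z \<omega>) x $ m) \<partial>Mw)"

end

theory Submission
  imports Defs
begin

text \<open>The second-order statistics of the quantized signals come from the arcsine law
  \<open>E[sgn U * sgn V] = (2/pi) * arcsin r\<close> for centred jointly Gaussian \<open>U\<close>, \<open>V\<close> with correlation \<open>r\<close>.
  Since only characteristic functions are given, it is proved by Fourier inversion of the sign function:
  \<open>sgn x\<close> is \<open>1/pi\<close> times the integral of \<open>sin (s * x) / s\<close> over the real line, and
  \<open>E[sin (s * U) * sin (t * V)] = exp (- (s\<^sup>2 + t\<^sup>2) / 2) * sinh (r * s * t)\<close> for unit variances. Dividing by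
  \<open>s * t\<close> and integrating over the plane gives \<open>2 * pi * arcsin r\<close>, because the derivative in \<open>r\<close> is the
  Gaussian integral \<open>2 * pi / sqrt (1 - r\<^sup>2)\<close>.

  All received samples, pilot and data, form one circularly-symmetric Gaussian vector, by independence of
  channels and noises; the arcsine law applied to real and imaginary parts of its entries gives \<open>C_rp\<close> and
  \<open>C_rrp\<close>. The trace formula is linearity of expectation together with the hermitian symmetry of
  \<open>C_rp\<close>, \<open>A_p\<close> and \<open>C_hk\<close>.\<close>

section \<open>A Gaussian double integral for the arcsine\<close>

lemma borel_measurable_cosh [measurable]: "(cosh :: real \<Rightarrow> real) \<in> borel_measurable borel"
  by (intro borel_measurable_continuous_onI continuous_intros)

lemma borel_measurable_sinh [measurable]: "(sinh :: real \<Rightarrow> real) \<in> borel_measurable borel"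
  by (intro borel_measurable_continuous_onI continuous_intros)

text \<open>Completing the square makes the integrand a constant multiple of the normal density with
  mean \<open>b / a\<close> and variance \<open>1 / a\<close>.\<close>

lemma nn_integral_exp_quadratic:
  fixes a b :: real
  assumes "0 < a"
  shows "(\<integral>\<^sup>+s. ennreal (exp (b * s - a * s\<^sup>2 / 2)) \<partial>lborel) = ennreal (sqrt (2 * pi / a) * exp (b\<^sup>2 / (2 * a)))"
proof -
  define \<sigma> where "\<sigma> = 1 / sqrt a"
  have \<sigma>: "\<sigma> > 0" and \<sigma>2: "\<sigma>\<^sup>2 = 1 / a"
    using assms by (simp_all add: \<sigma>_def power_divide)
  have eq: "exp (b * s - a * s\<^sup>2 / 2) = sqrt (2 * pi / a) * exp (b\<^sup>2 / (2 * a)) * normal_density (b / a) \<sigma> s" for s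
  proof -
    have "b * s - a * s\<^sup>2 / 2 = b\<^sup>2 / (2 * a) + - (s - b / a)\<^sup>2 / (2 * \<sigma>\<^sup>2)"
      unfolding \<sigma>2 using assms by (simp add: field_simps power2_eq_square)
    then show ?thesis
      using assms by (simp add: normal_density_def \<sigma>2 exp_add[symmetric])
  qed
  have "(\<integral>\<^sup>+s. ennreal (normal_density (b / a) \<sigma> s) \<partial>lborel) = 1"
    using \<sigma> by (subst nn_integral_eq_integral) auto
  then show ?thesis
    using assms by (simp add: eq ennreal_mult nn_integral_cmult)
qed

text \<open>For fixed \<open>s\<close> the \<open>t\<close>-integral is Gaussian with linear term
  \<open>q * s\<close> and produces \<open>exp (q\<^sup>2 * s\<^sup>2 / 2)\<close>. This lowers the
  quadratic coefficient in \<open>s\<close> from 1 to \<open>1 - q\<^sup>2\<close>, which stays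
  positive because \<open>\<bar>q\<bar> < 1\<close>.\<close>

lemma nn_integral_gauss_exp_mult:
  fixes q :: real
  assumes "\<bar>q\<bar> < 1"
  shows "(\<integral>\<^sup>+s. \<integral>\<^sup>+t. ennreal (exp (- (s\<^sup>2 + t\<^sup>2) / 2) * exp (q * (s * t))) \<partial>lborel \<partial>lborel)
    = ennreal (2 * pi / sqrt (1 - q\<^sup>2))"
proof -
  have q: "q\<^sup>2 < 1" using assms by (simp add: abs_square_less_1)
  have "(\<integral>\<^sup>+t. ennreal (exp (- (s\<^sup>2 + t\<^sup>2) / 2) * exp (q * (s * t))) \<partial>lborel)
      = ennreal (sqrt (2 * pi)) * ennreal (exp (0 * s - (1 - q\<^sup>2) * s\<^sup>2 / 2))" for s
  proof -
    have "(\<integral>\<^sup>+t. ennreal (exp (- (s\<^sup>2 + t\<^sup>2) / 2) * exp (q * (s * t))) \<partial>lborel)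
      = (\<integral>\<^sup>+t. ennreal (exp (- s\<^sup>2 / 2)) * ennreal (exp (q * s * t - 1 * t\<^sup>2 / 2)) \<partial>lborel)"
      by (intro nn_integral_cong) (simp add: ennreal_mult[symmetric] exp_add[symmetric] field_simps)
    also have "\<dots> = ennreal (exp (- s\<^sup>2 / 2)) * ennreal (sqrt (2 * pi / 1) * exp ((q * s)\<^sup>2 / (2 * 1)))"
      by (subst nn_integral_cmult) (simp_all add: nn_integral_exp_quadratic[of 1 "q * s", simplified])
    also have "\<dots> = ennreal (sqrt (2 * pi)) * ennreal (exp (0 * s - (1 - q\<^sup>2) * s\<^sup>2 / 2))"
      by (simp add: ennreal_mult[symmetric] exp_add[symmetric] mult.left_commute algebra_simps power_mult_distrib diff_divide_distrib)
    finally show ?thesis .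
  qed
  then have "(\<integral>\<^sup>+s. \<integral>\<^sup>+t. ennreal (exp (- (s\<^sup>2 + t\<^sup>2) / 2) * exp (q * (s * t))) \<partial>lborel \<partial>lborel)
     = ennreal (sqrt (2 * pi)) * (\<integral>\<^sup>+s. ennreal (exp (0 * s - (1 - q\<^sup>2) * s\<^sup>2 / 2)) \<partial>lborel)"
    by (simp only:) (rule nn_integral_cmult, simp)
  also have "\<dots> = ennreal (sqrt (2 * pi)) * ennreal (sqrt (2 * pi / (1 - q\<^sup>2)) * exp (0\<^sup>2 / (2 * (1 - q\<^sup>2))))"
    using q by (subst nn_integral_exp_quadratic) auto
  also have "\<dots> = ennreal (2 * pi / sqrt (1 - q\<^sup>2))"
    using q by (simp add: ennreal_mult[symmetric] real_sqrt_divide)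
  finally show ?thesis .
qed

text \<open>\<open>cosh\<close> is the average of the exponentials for \<open>q\<close> and
  \<open>- q\<close>, and both have the same integral since the value depends only on
  \<open>q\<^sup>2\<close>.\<close>

lemma nn_integral_gauss_cosh_mult:
  fixes q :: real
  assumes "\<bar>q\<bar> < 1"
  shows "(\<integral>\<^sup>+p. (case p of (s, t) \<Rightarrow> ennreal (exp (- (s\<^sup>2 + t\<^sup>2) / 2) * cosh (q * (s * t)))) \<partial>lborel)
    = ennreal (2 * pi / sqrt (1 - q\<^sup>2))"
proof -
  have q: "q\<^sup>2 < 1" using assms by (simp add: abs_square_less_1)
  define E where "E c = (\<lambda>(s, t). ennreal (exp (- (s\<^sup>2 + t\<^sup>2) / 2) * exp (c * (s * t))))" for c :: real
  have [measurable]: "E c \<in> borel_measurable (lborel \<Otimes>\<^sub>M lborel)" for c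
    unfolding E_def by measurable
  have E: "(\<integral>\<^sup>+p. E c p \<partial>lborel) = ennreal (2 * pi / sqrt (1 - c\<^sup>2))" if "\<bar>c\<bar> < 1" for c
    unfolding lborel_prod[symmetric]
    by (subst lborel.nn_integral_fst[symmetric])
       (simp_all add: nn_integral_gauss_exp_mult[OF that, symmetric] E_def)
  have "(\<integral>\<^sup>+p. (case p of (s, t) \<Rightarrow> ennreal (exp (- (s\<^sup>2 + t\<^sup>2) / 2) * cosh (q * (s * t)))) \<partial>lborel)
     = (\<integral>\<^sup>+p. ennreal (1/2) * (E q p + E (- q) p) \<partial>lborel)"
    by (intro nn_integral_cong)
       (auto simp: E_def cosh_def ennreal_plus[symmetric] ennreal_mult[symmetric] algebra_simps add_divide_distrib
             simp del: ennreal_plus ennreal_half)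
  also have "\<dots> = ennreal (1/2) * ((\<integral>\<^sup>+p. E q p \<partial>lborel) + (\<integral>\<^sup>+p. E (- q) p \<partial>lborel))"
    unfolding lborel_prod[symmetric]
    by (subst nn_integral_cmult, simp, subst nn_integral_add) simp_all
  also have "\<dots> = ennreal (2 * pi / sqrt (1 - q\<^sup>2))"
    using assms q
    by (simp add: E ennreal_plus[symmetric] ennreal_mult[symmetric] del: ennreal_plus ennreal_half)
  finally show ?thesis .
qed

lemma nn_integral_inverse_sqrt_arcsin:
  fixes r :: real
  assumes "0 \<le> r" "r \<le> 1"
  shows "(\<integral>\<^sup>+q. ennreal (1 / sqrt (1 - q\<^sup>2)) * indicator {0..r} q \<partial>lborel) = ennreal (arcsin r)"
proof -
  let ?f = "\<lambda>q. if q \<in> {0..r} then 1 / sqrt (1 - q\<^sup>2) else 0 :: real"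
  have "((\<lambda>q. 1 / sqrt (1 - q\<^sup>2)) has_integral (arcsin r - arcsin 0)) {0..r}"
  \<comment> \<open>For \<open>r = 1\<close> the derivative of \<open>arcsin\<close> blows up at the
    right endpoint, so differentiability is used in the open interval only, with continuity on the
    closed one.\<close>
  proof (rule fundamental_theorem_of_calculus_interior)
    show "continuous_on {0..r} arcsin"
      using assms by (intro continuous_on_arcsin' continuous_intros) auto
    show "(arcsin has_vector_derivative 1 / sqrt (1 - q\<^sup>2)) (at q)" if "q \<in> {0<..<r}" for q
      using DERIV_arcsin[of q] that assms
      by (auto simp: has_real_derivative_iff_has_vector_derivative[symmetric] inverse_eq_divide)
  qed fact
  then have "(?f has_integral arcsin r) UNIV"
    by (subst has_integral_restrict_UNIV) simp
  moreover have "0 \<le> ?f q" for q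
  proof -
    have "q\<^sup>2 \<le> 1" if "0 \<le> q" "q \<le> r" using that assms by (simp add: power_le_one)
    then show ?thesis by auto
  qed
  ultimately have "(\<integral>\<^sup>+q. ennreal (?f q) \<partial>lborel) = ennreal (arcsin r)"
    by (intro nn_integral_has_integral_lborel) auto
  then show ?thesis
    by (auto simp: indicator_def if_distrib intro!: nn_integral_cong
             elim!: back_subst[of "\<lambda>x. x = _"])
qed

lemma nn_integral_cosh_Icc:
  fixes r w :: real
  assumes "0 \<le> r" "w \<noteq> 0"
  shows "(\<integral>\<^sup>+q. ennreal (cosh (q * w)) * indicator {0..r} q \<partial>lborel) = ennreal (sinh (r * w) / w)"
proof -
  have "(\<integral>\<^sup>+q. ennreal (cosh (q * w)) * indicator {0..r} q \<partial>lborel)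
     = ennreal (sinh (r * w) / w - sinh (0 * w) / w)"
    using assms
    by (intro nn_integral_FTC_Icc) (auto intro!: derivative_eq_intros simp: cosh_def)
  then show ?thesis by simp
qed

text \<open>On the axes \<open>sinh (r * (s * t)) / (s * t)\<close> is 0 by the convention for
  division by zero, whereas the integral of \<open>cosh (q * (s * t))\<close> over \<open>q\<close>
  equals \<open>r\<close> there. The two expressions are interchangeable because the axes form a
  null set.\<close>

lemma AE_lborel_prod_nonzero:
  "AE p in (lborel :: (real \<times> real) measure). fst p * snd p \<noteq> 0"
proof -
  have "AE p in (lborel \<Otimes>\<^sub>M lborel :: (real \<times> real) measure). fst p * snd p \<noteq> 0"
  proof (rule lborel_pair.AE_pair_measure)
    show "{p \<in> space (lborel \<Otimes>\<^sub>M lborel). fst p * snd p \<noteq> (0::real)} \<in> sets (lborel \<Otimes>\<^sub>M lborel)"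
      by measurable
    show "AE s in lborel. AE t in lborel. fst (s, t) * snd (s, t) \<noteq> (0::real)"
      using AE_lborel_singleton[of "0::real"]
    proof eventually_elim
      case (elim s)
      show ?case using AE_lborel_singleton[of "0::real"]
        by eventually_elim (use elim in auto)
    qed
  qed
  then show ?thesis unfolding lborel_prod .
qed

text \<open>Integrating \<open>cosh (q * (s * t))\<close> over \<open>q\<close> from 0 to \<open>r\<close> gives \<open>sinh (r * (s * t)) / (s * t)\<close>;
  Tonelli moves the \<open>q\<close>-integral outside, where it becomes the integral defining \<open>arcsin\<close>. The endpoint
  \<open>r = 1\<close> is included, which later covers the diagonal of the covariance matrix.\<close>

lemma nn_integral_gauss_sinh_div:
  fixes r :: real
  assumes r: "0 \<le> r" "r \<le> 1"
  shows "(\<integral>\<^sup>+p. (case p of (s, t) \<Rightarrow> ennreal (exp (- (s\<^sup>2 + t\<^sup>2) / 2) * (sinh (r * (s * t)) / (s * t)))) \<partial>lborel)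
    = ennreal (2 * pi * arcsin r)"
proof -
  define G where "G p = exp (- ((fst p)\<^sup>2 + (snd p)\<^sup>2) / 2)" for p :: "real \<times> real"
  define w where "w p = fst p * snd p" for p :: "real \<times> real"
  have [measurable]: "G \<in> borel_measurable borel" "w \<in> borel_measurable borel"
    unfolding G_def w_def borel_prod[symmetric] by measurable
  have G0: "0 \<le> G p" for p by (simp add: G_def)
  have "(\<integral>\<^sup>+p. (case p of (s, t) \<Rightarrow> ennreal (exp (- (s\<^sup>2 + t\<^sup>2) / 2) * (sinh (r * (s * t)) / (s * t)))) \<partial>lborel)
    = (\<integral>\<^sup>+p. (\<integral>\<^sup>+q. ennreal (G p * cosh (q * w p)) * indicator {0..r} q \<partial>lborel) \<partial>lborel)"
  proof (rule nn_integral_cong_AE)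
    show "AE p in lborel. (case p of (s, t) \<Rightarrow> ennreal (exp (- (s\<^sup>2 + t\<^sup>2) / 2) * (sinh (r * (s * t)) / (s * t)))) =
      (\<integral>\<^sup>+q. ennreal (G p * cosh (q * w p)) * indicator {0..r} q \<partial>lborel)"
      using AE_lborel_prod_nonzero
    proof eventually_elim
      case (elim p)
      have "(\<integral>\<^sup>+q. ennreal (G p * cosh (q * w p)) * indicator {0..r} q \<partial>lborel)
        = ennreal (G p) * (\<integral>\<^sup>+q. ennreal (cosh (q * w p)) * indicator {0..r} q \<partial>lborel)"
        by (subst nn_integral_cmult[symmetric])
           (auto simp: ennreal_mult' G0 mult.assoc intro!: nn_integral_cong)
      also have "\<dots> = ennreal (G p * (sinh (r * w p) / w p))"
        using elim r by (simp add: nn_integral_cosh_Icc w_def ennreal_mult'[symmetric] G0)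
      finally show ?case
        by (simp add: G_def w_def case_prod_beta)
    qed
  qed
  also have "\<dots> = (\<integral>\<^sup>+q. (\<integral>\<^sup>+p. ennreal (G p * cosh (q * w p)) * indicator {0..r} q \<partial>lborel) \<partial>lborel)"
    by (rule lborel_pair.Fubini') simp
  also have "\<dots> = (\<integral>\<^sup>+q. ennreal (2 * pi) * (ennreal (1 / sqrt (1 - q\<^sup>2)) * indicator {0..r} q) \<partial>lborel)"
  proof (rule nn_integral_cong_AE)
    show "AE q in lborel. (\<integral>\<^sup>+p. ennreal (G p * cosh (q * w p)) * indicator {0..r} q \<partial>lborel) =
      ennreal (2 * pi) * (ennreal (1 / sqrt (1 - q\<^sup>2)) * indicator {0..r} q)"
      \<comment> \<open>The point \<open>q = 1\<close>, which lies in the interval when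
        \<open>r = 1\<close>, is discarded: there the quadratic form degenerates and the plane
        integral is not covered by \<open>nn_integral_gauss_cosh_mult\<close>.\<close>
      using AE_lborel_singleton[of "1::real"]
    proof eventually_elim
      case (elim q)
      show ?case
      proof (cases "q \<in> {0..r}")
        case True
        then have "\<bar>q\<bar> < 1" using elim r by auto
        from nn_integral_gauss_cosh_mult[OF this] True show ?thesis
          by (simp add: G_def w_def case_prod_beta ennreal_mult'[symmetric])
      qed simp
    qed
  qed
  also have "\<dots> = ennreal (2 * pi) * ennreal (arcsin r)"
    by (subst nn_integral_cmult) (simp_all add: nn_integral_inverse_sqrt_arcsin r)
  also have "\<dots> = ennreal (2 * pi * arcsin r)"
    by (simp add: ennreal_mult')
  finally show ?thesis .
qed

section \<open>The arcsine law\<close>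

text \<open>The integral over \<open>{\<epsilon>..T}\<close> is a difference of two sine integrals
  starting at 0, scaled by \<bar>x\<bar>. The integrand is even in \<open>s\<close>, so the negative
  half doubles the value.\<close>

lemma truncated_sine_integral:
  fixes x \<epsilon> T :: real
  assumes "0 < \<epsilon>" "\<epsilon> \<le> T"
  shows "(\<integral>s. indicator {s. \<epsilon> \<le> \<bar>s\<bar> \<and> \<bar>s\<bar> \<le> T} s * (sin (s * x) / s) \<partial>lborel)
    = 2 * (sgn x * (Si (T * \<bar>x\<bar>) - Si (\<epsilon> * \<bar>x\<bar>)))"
proof -
  let ?f = "\<lambda>s. sin (s * x) / s"
  have "(LBINT s=ereal 0..ereal \<epsilon>. ?f s) + (LBINT s=ereal \<epsilon>..ereal T. ?f s) = (LBINT s=ereal 0..ereal T. ?f s)"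
    using assms integrable_sinc'[of T x]
    by (intro interval_integral_sum) (auto simp: min_def max_def)
  then have "(LBINT s:{\<epsilon>..T}. ?f s) = sgn x * (Si (T * \<bar>x\<bar>) - Si (\<epsilon> * \<bar>x\<bar>))"
    using assms LBINT_I0c_sin_scale_divide[of T x] LBINT_I0c_sin_scale_divide[of \<epsilon> x]
    by (simp add: interval_integral_Icc algebra_simps zero_ereal_def)
  moreover have "set_integrable lborel {\<epsilon>..T} ?f"
    using assms by (intro borel_integrable_atLeastAtMost') (auto intro!: continuous_intros)
  ultimately have "has_bochner_integral lborel (\<lambda>s. indicator {\<epsilon>..T} s *\<^sub>R ?f s) (sgn x * (Si (T * \<bar>x\<bar>) - Si (\<epsilon> * \<bar>x\<bar>)))"
    by (simp add: has_bochner_integral_iff set_integrable_def set_lebesgue_integral_def)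
  also have "(\<lambda>s. indicator {\<epsilon>..T} s *\<^sub>R ?f s) =
      (\<lambda>s. indicator {0..} s *\<^sub>R (indicator {s. \<epsilon> \<le> \<bar>s\<bar> \<and> \<bar>s\<bar> \<le> T} s * ?f s))"
    using assms by (auto simp: fun_eq_iff indicator_def)
  finally have "has_bochner_integral lborel (\<lambda>s. indicator {s. \<epsilon> \<le> \<bar>s\<bar> \<and> \<bar>s\<bar> \<le> T} s * ?f s)
      (2 *\<^sub>R (sgn x * (Si (T * \<bar>x\<bar>) - Si (\<epsilon> * \<bar>x\<bar>))))"
    by (rule has_bochner_integral_even_function) (simp add: indicator_def)
  then show ?thesis
    by (simp add: has_bochner_integral_iff)
qed

text \<open>For nonzero \<open>x\<close> the Dirichlet integral gives the limit
  \<open>pi / 2\<close> at the outer cutoff, and continuity of \<open>Si\<close> gives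
  \<open>Si 0 = 0\<close> at the inner one. For \<open>x = 0\<close> everything vanishes with
  \<open>sgn 0\<close>.\<close>

lemma tendsto_sgn_Si:
  fixes x :: real
  shows "(\<lambda>n. 2 * (sgn x * (Si (real (Suc n) * \<bar>x\<bar>) - Si (1 / real (Suc n) * \<bar>x\<bar>)))) \<longlonglongrightarrow> pi * sgn x"
proof (cases "x = 0")
  case False
  have "filterlim (\<lambda>n. real (Suc n)) at_top sequentially"
    by (rule filterlim_compose[OF filterlim_real_sequentially filterlim_Suc])
  then have "filterlim (\<lambda>n. real (Suc n) * \<bar>x\<bar>) at_top sequentially"
    using False by (intro filterlim_at_top_mult_tendsto_pos[OF tendsto_const]) auto
  then have 1: "(\<lambda>n. Si (real (Suc n) * \<bar>x\<bar>)) \<longlonglongrightarrow> pi / 2"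
    by (rule filterlim_compose[OF Si_at_top])
  have "(\<lambda>n. 1 / real (Suc n)) \<longlonglongrightarrow> 0"
    using LIMSEQ_inverse_real_of_nat by (simp add: inverse_eq_divide)
  then have "(\<lambda>n. 1 / real (Suc n) * \<bar>x\<bar>) \<longlonglongrightarrow> 0"
    by (rule tendsto_mult_left_zero)
  then have 2: "(\<lambda>n. Si (1 / real (Suc n) * \<bar>x\<bar>)) \<longlonglongrightarrow> Si 0"
    by (rule isCont_tendsto_compose[OF isCont_Si])
  have "Si 0 = 0" by (simp add: Si_def zero_ereal_def)
  then show ?thesis
    using tendsto_mult[OF tendsto_const[of 2] tendsto_mult[OF tendsto_const[of "sgn x"] tendsto_diff[OF 1 2]]]
    by (simp add: mult.commute)
qed simp

text \<open>The product of sines is half the difference of \<open>cos (s * U - t * V)\<close> and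
  \<open>cos (s * U + t * V)\<close>. Their means are real parts of the joint characteristic
  function and differ only in the sign of the cross term, which produces the
  \<open>sinh\<close>.\<close>

lemma (in prob_space) expectation_sin_mult_sin:
  fixes U V :: "'a \<Rightarrow> real"
  assumes [measurable]: "U \<in> borel_measurable M" "V \<in> borel_measurable M"
    and char: "\<And>s t. (\<integral>\<omega>. cis (s * U \<omega> + t * V \<omega>) \<partial>M)
      = complex_of_real (exp (- (s\<^sup>2 + 2 * r * (s * t) + t\<^sup>2) / 2))"
  shows "(\<integral>\<omega>. sin (s * U \<omega>) * sin (t * V \<omega>) \<partial>M) = exp (- (s\<^sup>2 + t\<^sup>2) / 2) * sinh (r * (s * t))"
proof -
  have cos: "(\<integral>\<omega>. cos (s * U \<omega> + t * V \<omega>) \<partial>M) = exp (- (s\<^sup>2 + 2 * r * (s * t) + t\<^sup>2) / 2)" for s t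
  proof -
    have "integrable M (\<lambda>\<omega>. cis (s * U \<omega> + t * V \<omega>))"
      by (rule integrable_const_bound[where B = 1]) (auto simp: cis_conv_exp)
    from integral_Re[OF this] show ?thesis
      by (simp add: char)
  qed
  have int: "integrable M (\<lambda>\<omega>. cos (s * U \<omega> + t * V \<omega>))" for s t
    by (rule integrable_const_bound[where B = 1]) auto
  have "(\<integral>\<omega>. sin (s * U \<omega>) * sin (t * V \<omega>) \<partial>M)
     = (\<integral>\<omega>. (cos (s * U \<omega> + (- t) * V \<omega>) - cos (s * U \<omega> + t * V \<omega>)) / 2 \<partial>M)"
    by (intro Bochner_Integration.integral_cong) (simp_all add: cos_add cos_diff field_simps)
  also have "\<dots> = (exp (- (s\<^sup>2 + 2 * r * (s * - t) + (- t)\<^sup>2) / 2) - exp (- (s\<^sup>2 + 2 * r * (s * t) + t\<^sup>2) / 2)) / 2"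
    by (simp only: integral_divide_zero Bochner_Integration.integral_diff[OF int int] cos)
  also have "\<dots> = exp (- (s\<^sup>2 + t\<^sup>2) / 2) * sinh (r * (s * t))"
    by (simp add: sinh_def right_diff_distrib exp_add[symmetric] diff_divide_distrib add_divide_distrib algebra_simps)
  finally show ?thesis .
qed

text \<open>The cutoff \<open>1 / Suc n \<le> \<bar>s\<bar>\<close> near 0 keeps the integrand bounded, so that Fubini needs no moments
  of \<open>U\<close> and \<open>V\<close>. The bound \<open>r \<le> 1\<close> holds because characteristic functions are bounded by 1.\<close>

lemma (in prob_space) arcsine_law_standardized_nonneg:
  fixes U V :: "'a \<Rightarrow> real"
  assumes meas [measurable]: "U \<in> borel_measurable M" "V \<in> borel_measurable M"
    and r: "0 \<le> r"
    and char: "\<And>s t. (\<integral>\<omega>. cis (s * U \<omega> + t * V \<omega>) \<partial>M)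
      = complex_of_real (exp (- (s\<^sup>2 + 2 * r * (s * t) + t\<^sup>2) / 2))"
  shows "(\<integral>\<omega>. sgn (U \<omega>) * sgn (V \<omega>) \<partial>M) = 2 / pi * arcsin r"
proof -
  have r1: "r \<le> 1"
  proof -
    \<comment> \<open>At \<open>s = 1\<close>, \<open>t = - 1\<close> the characteristic function
      equals \<open>exp (r - 1)\<close>.\<close>
    have "norm (\<integral>\<omega>. cis (1 * U \<omega> + (- 1) * V \<omega>) \<partial>M) \<le> (\<integral>\<omega>. norm (cis (1 * U \<omega> + (- 1) * V \<omega>)) \<partial>M)"
      by (rule integral_norm_bound)
    also have "\<dots> = 1" by (simp add: prob_space)
    finally show ?thesis unfolding char by simp
  qed
  define A where "A n = {s::real. 1 / real (Suc n) \<le> \<bar>s\<bar> \<and> \<bar>s\<bar> \<le> real (Suc n)}" for n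
  define a where "a n x s = indicator (A n) s * (sin (s * x) / s)" for n and x s :: real
  have [measurable]: "A n \<in> sets borel" for n
    unfolding A_def by measurable
  have a_meas [measurable]: "(\<lambda>x. a n (f x) (g x)) \<in> borel_measurable N"
    if [measurable]: "f \<in> borel_measurable N" "g \<in> borel_measurable N" for n and f g :: "'c \<Rightarrow> real" and N
    unfolding a_def by measurable
  have a_bound: "\<bar>a n x s\<bar> \<le> real (Suc n)" for n x s
  proof (cases "s \<in> A n")
    case True
    then have s: "1 / real (Suc n) \<le> \<bar>s\<bar>" by (simp add: A_def)
    then have "0 < \<bar>s\<bar>" by (rule less_le_trans[rotated]) simp
    have "\<bar>a n x s\<bar> = \<bar>sin (s * x)\<bar> / \<bar>s\<bar>" using True by (simp add: a_def)
    also have "\<dots> \<le> 1 / (1 / real (Suc n))"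
      using s by (intro frac_le) auto
    finally show ?thesis by simp
  qed (simp add: a_def)
  have a_supp: "a n x s = 0" if "\<bar>s\<bar> > real (Suc n)" for n x s
    using that by (simp add: a_def A_def)
  define g where "g n x = (\<integral>s. a n x s \<partial>lborel)" for n x
  have g: "g n x = 2 * (sgn x * (Si (real (Suc n) * \<bar>x\<bar>) - Si (1 / real (Suc n) * \<bar>x\<bar>)))" for n x
    unfolding g_def a_def A_def by (rule truncated_sine_integral) (auto simp: field_simps)
  obtain B where B: "\<And>T. \<bar>Si T\<bar> \<le> B"
    using bounded_Si by blast
  \<comment> \<open>\<open>g n\<close> is the truncated version of \<open>pi * sgn\<close>.
    Boundedness of \<open>Si\<close> makes the bound uniform in \<open>n\<close>, as dominated
    convergence requires.\<close>
  have g_bound: "\<bar>g n x\<bar> \<le> 4 * B" for n x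
  proof -
    have "\<bar>g n x\<bar> \<le> 2 * (1 * (\<bar>Si (real (Suc n) * \<bar>x\<bar>)\<bar> + \<bar>Si (1 / real (Suc n) * \<bar>x\<bar>)\<bar>))"
      unfolding g abs_mult abs_numeral
      by (intro mult_left_mono mult_mono abs_triangle_ineq4) (auto simp: sgn_if)
    also have "\<dots> \<le> 2 * (1 * (B + B))" by (intro mult_left_mono add_mono B) auto
    finally show ?thesis by simp
  qed
  have [measurable]: "(\<lambda>x. g n (f x)) \<in> borel_measurable N"
    if [measurable]: "f \<in> borel_measurable N" for n and f :: "'c \<Rightarrow> real" and N
    unfolding g_def by measurable
  define K where "K p = (case p of (s, t) \<Rightarrow> exp (- (s\<^sup>2 + t\<^sup>2) / 2) * (sinh (r * (s * t)) / (s * t)))"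
    for p :: "real \<times> real"
  have K_meas [measurable]: "K \<in> borel_measurable borel"
    unfolding K_def borel_prod[symmetric] by measurable
  \<comment> \<open>This is where \<open>0 \<le> r\<close> matters: \<open>sinh (r * w)\<close> then
    never has the opposite sign to \<open>w\<close>. Nonnegativity turns the value of the
    \<open>nn_integral\<close> into Bochner integrability of \<open>K\<close>.\<close>
  have K_nonneg: "0 \<le> K p" for p
  proof -
    have "0 \<le> sinh (r * w) / w" for w
      using r by (cases w "0::real" rule: linorder_cases) (auto simp: divide_nonpos_neg mult_le_0_iff)
    from mult_nonneg_nonneg[OF exp_ge_zero this] show ?thesis
      unfolding K_def case_prod_beta .
  qed
  have "(\<integral>\<^sup>+p. ennreal (K p) \<partial>lborel) = ennreal (2 * pi * arcsin r)"
    using nn_integral_gauss_sinh_div[OF r r1] unfolding K_def case_prod_beta .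
  then have "has_bochner_integral lborel K (2 * pi * arcsin r)"
    using r r1 by (intro has_bochner_integral_nn_integral) (auto simp: K_nonneg arcsin_nonneg)
  then have K_int: "integrable lborel K" and K_eq: "(\<integral>p. K p \<partial>lborel) = 2 * pi * arcsin r"
    by (auto simp: has_bochner_integral_iff)
  \<comment> \<open>The truncated integrand is bounded and vanishes for \<open>p\<close> outside the
    box \<open>S\<close>, hence is integrable on the product space. After the exchange, the inner
    expectation at a fixed frequency pair is given by
    \<open>expectation_sin_mult_sin\<close>.\<close>
  have fubini: "(\<integral>\<omega>. g n (U \<omega>) * g n (V \<omega>) \<partial>M) = (\<integral>p. indicator (A n \<times> A n) p * K p \<partial>lborel)" for n
  proof -
    let ?f = "\<lambda>\<omega> p. a n (U \<omega>) (fst p) * a n (V \<omega>) (snd p)"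
    interpret P: pair_sigma_finite M "lborel :: (real \<times> real) measure" ..
    define S where "S = cbox (- real (Suc n), - real (Suc n)) (real (Suc n), real (Suc n))"
    have S_fin: "emeasure lborel S < \<infinity>" and [measurable]: "S \<in> sets borel"
      unfolding S_def by (auto intro!: emeasure_bounded_finite simp del: infinity_ennreal_def)
    have f_bound: "\<bar>a n x s * a n y t\<bar> \<le> real (Suc n) * real (Suc n)" for x y s t
      unfolding abs_mult by (intro mult_mono a_bound) auto
    have f_supp: "a n x (fst p) * a n y (snd p) = 0" if "p \<notin> S" for x y p
      using that a_supp[of n "fst p"] a_supp[of n "snd p"] by (cases p) (auto simp: S_def cbox_Pair_eq)
    have int1: "integrable lborel (\<lambda>p. a n x (fst p) * a n y (snd p))" for x y
    proof (rule integrableI_bounded_set[where A = S and B = "real (Suc n) * real (Suc n)"])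
      show "(\<lambda>p. a n x (fst p) * a n y (snd p)) \<in> borel_measurable lborel"
        unfolding lborel_prod[symmetric] by measurable
    qed (use f_bound f_supp S_fin in auto)
    have prod: "g n x * g n y = (\<integral>p. a n x (fst p) * a n y (snd p) \<partial>lborel)" for x y
      using lborel_pair.integral_fst'[of "\<lambda>p. a n x (fst p) * a n y (snd p)"] int1[of x y]
      by (simp add: lborel_prod g_def)
    have int2: "integrable (M \<Otimes>\<^sub>M lborel) (case_prod ?f)"
    proof (rule integrableI_bounded_set[where A = "space M \<times> S" and B = "real (Suc n) * real (Suc n)"])
      show "case_prod ?f \<in> borel_measurable (M \<Otimes>\<^sub>M lborel)"
        unfolding lborel_prod[symmetric] by measurable
      show "emeasure (M \<Otimes>\<^sub>M lborel) (space M \<times> S) < \<infinity>"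
        by (subst lborel.emeasure_pair_measure_Times)
           (use S_fin in \<open>auto simp: emeasure_space_1\<close>)
      show "AE x in M \<Otimes>\<^sub>M lborel. x \<notin> space M \<times> S \<longrightarrow> (case x of (\<omega>, p) \<Rightarrow> ?f \<omega> p) = 0"
        by (intro AE_I2) (auto simp: space_pair_measure simp del: mult_eq_0_iff intro!: f_supp)
    qed (use f_bound in auto)
    have "(\<integral>\<omega>. g n (U \<omega>) * g n (V \<omega>) \<partial>M) = (\<integral>\<omega>. (\<integral>p. ?f \<omega> p \<partial>lborel) \<partial>M)"
      by (simp add: prod)
    also have "\<dots> = (\<integral>p. (\<integral>\<omega>. ?f \<omega> p \<partial>M) \<partial>lborel)"
      by (rule P.Fubini_integral[OF int2, symmetric])
    also have "\<dots> = (\<integral>p. indicator (A n \<times> A n) p * K p \<partial>lborel)"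
    proof (rule Bochner_Integration.integral_cong[OF refl])
      fix p :: "real \<times> real"
      obtain s t where p: "p = (s, t)" by force
      have "(\<integral>\<omega>. ?f \<omega> p \<partial>M) = (\<integral>\<omega>. indicator (A n \<times> A n) p / (s * t) * (sin (s * U \<omega>) * sin (t * V \<omega>)) \<partial>M)"
        by (rule Bochner_Integration.integral_cong) (auto simp: p a_def indicator_def)
      also have "\<dots> = indicator (A n \<times> A n) p / (s * t) * (exp (- (s\<^sup>2 + t\<^sup>2) / 2) * sinh (r * (s * t)))"
        by (subst integral_mult_right_zero) (simp only: expectation_sin_mult_sin[OF meas char])
      finally show "(\<integral>\<omega>. ?f \<omega> p \<partial>M) = indicator (A n \<times> A n) p * K p"
        by (simp add: p K_def)
    qed
    finally show ?thesis .
  qed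
  have "(\<lambda>n. \<integral>\<omega>. g n (U \<omega>) * g n (V \<omega>) \<partial>M) \<longlonglongrightarrow> (\<integral>\<omega>. pi * sgn (U \<omega>) * (pi * sgn (V \<omega>)) \<partial>M)"
  proof (rule integral_dominated_convergence[where w = "\<lambda>_. 4 * B * (4 * B)"])
    show "AE \<omega> in M. (\<lambda>n. g n (U \<omega>) * g n (V \<omega>)) \<longlonglongrightarrow> pi * sgn (U \<omega>) * (pi * sgn (V \<omega>))"
      unfolding g by (intro AE_I2 tendsto_mult tendsto_sgn_Si)
    show "AE \<omega> in M. norm (g n (U \<omega>) * g n (V \<omega>)) \<le> 4 * B * (4 * B)" for n
      unfolding real_norm_def abs_mult
      by (intro AE_I2 mult_mono g_bound order_trans[OF abs_ge_zero g_bound]) auto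
  qed auto
  moreover have "(\<lambda>n. \<integral>p. indicator (A n \<times> A n) p * K p \<partial>lborel) \<longlonglongrightarrow> (\<integral>p. K p \<partial>lborel)"
  \<comment> \<open>\<open>K\<close> dominates its own truncations. A point off the axes eventually
    lies in \<open>A n \<times> A n\<close>, and on the axes \<open>K\<close> is 0 by division by
    zero, so convergence holds at every point.\<close>
  proof (rule integral_dominated_convergence[where w = K])
    have ev: "eventually (\<lambda>n. s \<in> A n) sequentially" if "s \<noteq> 0" for s
    proof -
      obtain N where N: "max \<bar>s\<bar> (1 / \<bar>s\<bar>) < real N" using reals_Archimedean2 by blast
      show ?thesis
        using eventually_ge_at_top[of N]
      proof eventually_elim
        case (elim n)
        then have "real N \<le> real (Suc n)" by simp
        then have "\<bar>s\<bar> \<le> real (Suc n)" "1 / \<bar>s\<bar> \<le> real (Suc n)" using N by linarith+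
        then show ?case using that by (simp add: A_def field_simps)
      qed
    qed
    have "(\<lambda>n. indicator (A n \<times> A n) p * K p) \<longlonglongrightarrow> K p" for p
    proof (cases "fst p \<noteq> 0 \<and> snd p \<noteq> 0")
      case True
      then have "eventually (\<lambda>n. indicator (A n \<times> A n) p * K p = K p) sequentially"
        using eventually_conj[OF ev[of "fst p"] ev[of "snd p"]]
        by (auto elim!: eventually_mono simp: indicator_def mem_Times_iff)
      then show ?thesis by (rule tendsto_eventually)
    next
      case False
      then have "K p = 0" by (cases p) (auto simp: K_def)
      then show ?thesis by simp
    qed
    then show "AE p in lborel. (\<lambda>n. indicator (A n \<times> A n) p * K p) \<longlonglongrightarrow> K p" by simp
    have [measurable]: "A n \<times> A n \<in> sets borel" for n
      unfolding borel_prod[symmetric] by simp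
    show "(\<lambda>p. indicator (A n \<times> A n) p * K p) \<in> borel_measurable lborel" for n
      by measurable
  qed (auto simp: K_int K_nonneg indicator_def)
  ultimately have "(\<integral>\<omega>. pi * sgn (U \<omega>) * (pi * sgn (V \<omega>)) \<partial>M) = 2 * pi * arcsin r"
    unfolding fubini K_eq by (rule LIMSEQ_unique)
  moreover have "(\<integral>\<omega>. pi * sgn (U \<omega>) * (pi * sgn (V \<omega>)) \<partial>M) = pi * pi * (\<integral>\<omega>. sgn (U \<omega>) * sgn (V \<omega>) \<partial>M)"
    by (subst integral_mult_right_zero[symmetric]) (simp add: mult_ac)
  ultimately show ?thesis
    by (simp add: field_simps)
qed

text \<open>Signs do not change under positive scaling, so both variances can be normalized to 1.
  Negative correlation is reduced to the positive case by replacing \<open>V\<close> with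
  \<open>- V\<close>, which negates both sides.\<close>

lemma (in prob_space) arcsine_law:
  fixes U V :: "'a \<Rightarrow> real"
  assumes [measurable]: "U \<in> borel_measurable M" "V \<in> borel_measurable M"
    and ab: "0 < a" "0 < b"
    and char: "\<And>s t. (\<integral>\<omega>. cis (s * U \<omega> + t * V \<omega>) \<partial>M)
      = complex_of_real (exp (- (a * s\<^sup>2 + 2 * c * (s * t) + b * t\<^sup>2) / 2))"
  shows "(\<integral>\<omega>. sgn (U \<omega>) * sgn (V \<omega>) \<partial>M) = 2 / pi * arcsin (c / sqrt (a * b))"
proof -
  define r where "r = c / sqrt (a * b)"
  have char': "(\<integral>\<omega>. cis (s * (U \<omega> / sqrt a) + t * (V \<omega> / sqrt b)) \<partial>M)
      = complex_of_real (exp (- (s\<^sup>2 + 2 * r * (s * t) + t\<^sup>2) / 2))" for s t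
    using char[of "s / sqrt a" "t / sqrt b"] ab
    by (simp add: r_def power_divide real_sqrt_mult mult.commute)
  show ?thesis
  proof (cases "0 \<le> r")
    case True
    from arcsine_law_standardized_nonneg[OF _ _ this char'] show ?thesis
      using ab by (simp add: sgn_divide sgn_mult r_def)
  next
    case False
    have "(\<integral>\<omega>. cis (s * (U \<omega> / sqrt a) + t * (- V \<omega> / sqrt b)) \<partial>M)
      = complex_of_real (exp (- (s\<^sup>2 + 2 * (- r) * (s * t) + t\<^sup>2) / 2))" for s t
      using char'[of s "- t"] by simp
    moreover have "\<bar>r\<bar> \<le> 1"
    proof -
      \<comment> \<open>With \<open>s = t = 1\<close> the characteristic function is
        \<open>exp (- (1 + r))\<close>, so \<open>- 1 \<le> r\<close>. Oddness of
        \<open>arcsin\<close> is available only on the interval from -1 to 1.\<close>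
      have "norm (\<integral>\<omega>. cis (1 * (U \<omega> / sqrt a) + 1 * (V \<omega> / sqrt b)) \<partial>M)
          \<le> (\<integral>\<omega>. norm (cis (1 * (U \<omega> / sqrt a) + 1 * (V \<omega> / sqrt b))) \<partial>M)"
        by (rule integral_norm_bound)
      also have "\<dots> = 1" by (simp add: prob_space)
      finally show ?thesis using False unfolding char' by simp
    qed
    moreover from this have "arcsin (- r) = - arcsin r"
      by (intro arcsin_minus) auto
    ultimately show ?thesis
      using arcsine_law_standardized_nonneg[of "\<lambda>\<omega>. U \<omega> / sqrt a" "\<lambda>\<omega>. - V \<omega> / sqrt b" "- r"] False ab
      unfolding r_def[symmetric] by (simp add: sgn_divide sgn_minus)
  qed
qed

section \<open>One-bit quantization of complex Gaussian vectors\<close>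

lemma borel_measurable_cis [measurable]: "cis \<in> borel_measurable borel"
  unfolding cis_conv_exp[abs_def] by measurable

lemma cis_sum: "finite A \<Longrightarrow> cis (\<Sum>i\<in>A. u i) = (\<Prod>i\<in>A. cis (u i))"
  by (induction rule: finite_induct) (simp_all flip: cis_mult)

lemma integrable_cis_Re:
  assumes "prob_space M" "f \<in> borel_measurable M"
  shows "integrable M (\<lambda>\<omega>. cis (Re (f \<omega>)))"
proof -
  interpret prob_space M by fact
  note [measurable] = assms(2)
  show ?thesis
    by (rule integrable_const_bound[where B = 1]) auto
qed

lemma borel_measurable_vec_nth [measurable (raw)]:
  fixes f :: "'w \<Rightarrow> 'b::real_normed_vector^'n::finite"
  shows "f \<in> borel_measurable M \<Longrightarrow> (\<lambda>\<omega>. f \<omega> $ i) \<in> borel_measurable M"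
  by (rule borel_measurable_continuous_on[OF linear_continuous_on[OF bounded_linear_vec_nth]])

text \<open>The test vector is a sum of two axis vectors, so \<open>i = j\<close> is allowed and
  diagonal covariance entries need no separate argument.\<close>

lemma sum_two_axes:
  fixes f :: "'n::finite \<Rightarrow> complex"
  shows "(\<Sum>l\<in>UNIV. cnj ((axis i \<alpha> + axis j \<beta>) $ l) * f l) = cnj \<alpha> * f i + cnj \<beta> * f j"
    "(\<Sum>l\<in>UNIV. f l * (axis i \<alpha> + axis j \<beta>) $ l) = f i * \<alpha> + f j * \<beta>"
  by (simp_all add: axis_def algebra_simps sum.distrib if_distrib[of cnj] if_distrib[of "\<lambda>c. c * _"] if_distrib[of "\<lambda>c. _ * c"] cong: if_cong)

text \<open>The characteristic function is evaluated at a test vector supported on \<open>i\<close>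
  and \<open>j\<close>. Hermitian symmetry makes the diagonal real and the two cross terms conjugate
  to each other, so they add up to twice a real part.\<close>

lemma cgauss_pair_char:
  fixes Y :: "'w \<Rightarrow> complex^'n::finite"
  assumes "cgauss M Y S" "hermitian S"
  shows "(\<integral>\<omega>. cis (Re (cnj \<alpha> * Y \<omega> $ i + cnj \<beta> * Y \<omega> $ j)) \<partial>M) =
    complex_of_real (exp (- ((cmod \<alpha>)\<^sup>2 * Re (S $ i $ i) + 2 * Re (cnj \<alpha> * \<beta> * S $ i $ j)
      + (cmod \<beta>)\<^sup>2 * Re (S $ j $ j)) / 4))"
proof -
  have herm: "S $ k $ l = cnj (S $ l $ k)" for k l
    using assms(2) unfolding hermitian_def by blast
  have real: "S $ k $ k = complex_of_real (Re (S $ k $ k))" for k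
    using arg_cong[OF herm[of k k], of Im] by (simp add: complex_eq_iff)
  define t :: "complex^'n" where "t = axis i \<alpha> + axis j \<beta>"
  have "(\<Sum>k\<in>UNIV. \<Sum>l\<in>UNIV. cnj (t $ k) * S $ k $ l * t $ l) =
     (\<Sum>k\<in>UNIV. cnj (t $ k) * (\<Sum>l\<in>UNIV. S $ k $ l * t $ l))"
    by (simp add: sum_distrib_left mult.assoc)
  also have "\<dots> = cnj \<alpha> * \<alpha> * S $ i $ i + (cnj \<alpha> * \<beta> * S $ i $ j + cnj (cnj \<alpha> * \<beta> * S $ i $ j)) + cnj \<beta> * \<beta> * S $ j $ j"
    unfolding t_def sum_two_axes herm[of j i] by (simp add: algebra_simps)
  also have "\<dots> = complex_of_real ((cmod \<alpha>)\<^sup>2 * Re (S $ i $ i) + 2 * Re (cnj \<alpha> * \<beta> * S $ i $ j)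
      + (cmod \<beta>)\<^sup>2 * Re (S $ j $ j))"
    unfolding complex_add_cnj
    by (subst real[of i], subst real[of j]) (simp only: of_real_add of_real_mult complex_norm_square mult.commute[of "cnj _"])
  finally have quad: "(\<Sum>k\<in>UNIV. \<Sum>l\<in>UNIV. cnj (t $ k) * S $ k $ l * t $ l) = \<dots>" .
  have lin: "(\<Sum>l\<in>UNIV. cnj (t $ l) * Y \<omega> $ l) = cnj \<alpha> * Y \<omega> $ i + cnj \<beta> * Y \<omega> $ j" for \<omega>
    unfolding t_def by (rule sum_two_axes)
  have "(\<integral>\<omega>. cis (Re (\<Sum>l\<in>UNIV. cnj (t $ l) * Y \<omega> $ l)) \<partial>M)
      = exp (- (\<Sum>k\<in>UNIV. \<Sum>l\<in>UNIV. cnj (t $ k) * S $ k $ l * t $ l) / 4)"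
    using assms(1) unfolding cgauss_def by blast
  then show ?thesis
    unfolding lin quad by (simp add: exp_of_real[symmetric])
qed

text \<open>The unit phases select components: 1 gives the real part, \<open>\<i>\<close> the
  imaginary part and \<open>- \<i>\<close> its negative, so one statement serves all pairings. Each
  component has half the complex variance, and these halves cancel in the correlation
  coefficient.\<close>

lemma cgauss_sign_correlation:
  fixes Y :: "'w \<Rightarrow> complex^'n::finite"
  assumes "prob_space M" "cgauss M Y S" "hermitian S"
    and pos: "0 < Re (S $ i $ i)" "0 < Re (S $ j $ j)"
    and unit: "cmod \<alpha> = 1" "cmod \<beta> = 1"
  shows "(\<integral>\<omega>. sgn (Re (cnj \<alpha> * Y \<omega> $ i)) * sgn (Re (cnj \<beta> * Y \<omega> $ j)) \<partial>M)
    = Omega (Re (cnj \<alpha> * \<beta> * S $ i $ j) / sqrt (Re (S $ i $ i) * Re (S $ j $ j)))"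
proof -
  interpret prob_space M by fact
  have [measurable]: "Y \<in> borel_measurable M" using assms(2) by (simp add: cgauss_def)
  have half_div_half: "x / 2 / (y / 2) = x / y" for x y :: real by simp
  have "(\<integral>\<omega>. sgn (Re (cnj \<alpha> * Y \<omega> $ i)) * sgn (Re (cnj \<beta> * Y \<omega> $ j)) \<partial>M)
    = 2 / pi * arcsin ((Re (cnj \<alpha> * \<beta> * S $ i $ j) / 2) / sqrt ((Re (S $ i $ i) / 2) * (Re (S $ j $ j) / 2)))"
  proof (rule arcsine_law)
    show "(\<lambda>\<omega>. Re (cnj \<alpha> * Y \<omega> $ i)) \<in> borel_measurable M" "(\<lambda>\<omega>. Re (cnj \<beta> * Y \<omega> $ j)) \<in> borel_measurable M"
      by measurable
    fix s t :: real
    have *: "s * Re (cnj \<alpha> * Y \<omega> $ i) + t * Re (cnj \<beta> * Y \<omega> $ j)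
      = Re (cnj (complex_of_real s * \<alpha>) * Y \<omega> $ i + cnj (complex_of_real t * \<beta>) * Y \<omega> $ j)" for \<omega>
      by (simp add: algebra_simps)
    have **: "Re (cnj (complex_of_real s * \<alpha>) * (complex_of_real t * \<beta>) * S $ i $ j) = s * t * Re (cnj \<alpha> * \<beta> * S $ i $ j)"
      by (simp add: algebra_simps)
    show "(\<integral>\<omega>. cis (s * Re (cnj \<alpha> * Y \<omega> $ i) + t * Re (cnj \<beta> * Y \<omega> $ j)) \<partial>M) =
      complex_of_real (exp (- (Re (S $ i $ i) / 2 * s\<^sup>2 + 2 * (Re (cnj \<alpha> * \<beta> * S $ i $ j) / 2) * (s * t)
        + Re (S $ j $ j) / 2 * t\<^sup>2) / 2))"
      unfolding * cgauss_pair_char[OF assms(2,3)] **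
      by (simp only: norm_mult norm_of_real unit) (simp add: field_simps)
  qed (use pos in auto)
  also have "sqrt ((Re (S $ i $ i) / 2) * (Re (S $ j $ j) / 2)) = sqrt (Re (S $ i $ i) * Re (S $ j $ j)) / 2"
    by (simp add: real_sqrt_divide real_sqrt_mult)
  finally show ?thesis
    by (simp only: Omega_def half_div_half)
qed

text \<open>The minus sign from conjugation is moved inside as \<open>sgn (- Im d)\<close>, so that
  the last term is again a sign correlation, with phase \<open>- \<i>\<close>.\<close>

lemma quant_mult_cnj:
  assumes "0 \<le> \<rho>"
  shows "quant \<rho> K c * cnj (quant \<rho> K d) = complex_of_real ((\<rho> * real K + 1) / 2) *
    (complex_of_real (sgn (Re c) * sgn (Re d)) + complex_of_real (sgn (Im c) * sgn (Im d))
     + \<i> * (complex_of_real (sgn (Im c) * sgn (Re d)) + complex_of_real (sgn (Re c) * sgn (- Im d))))"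
proof -
  have "complex_of_real (sqrt ((\<rho> * real K + 1) / 2)) * complex_of_real (sqrt ((\<rho> * real K + 1) / 2))
     = complex_of_real ((\<rho> * real K + 1) / 2)"
    using assms unfolding of_real_mult[symmetric] by simp
  moreover have "q * X * cnj (q * Y) = (q * cnj q) * (X * cnj Y)" for q X Y :: complex
    by simp
  ultimately show ?thesis
    unfolding quant_def by (simp only: complex_cnj_complex_of_real) (simp add: sgn_minus algebra_simps)
qed

text \<open>By circular symmetry the Re-Re and Im-Im sign correlations agree, as do the Im-Re and
  Re-(-Im) ones. Each pair doubles and cancels the factor 1/2 of the quantizer power.\<close>

lemma cgauss_quant_correlation:
  fixes Y :: "'w \<Rightarrow> complex^'n::finite"
  assumes "prob_space M" "cgauss M Y S" "hermitian S" "0 \<le> \<rho>"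
    and pos: "0 < Re (S $ i $ i)" "0 < Re (S $ j $ j)"
  defines "c \<equiv> S $ i $ j / complex_of_real (sqrt (Re (S $ i $ i) * Re (S $ j $ j)))"
  shows "(\<integral>\<omega>. quant \<rho> K (Y \<omega> $ i) * cnj (quant \<rho> K (Y \<omega> $ j)) \<partial>M)
    = complex_of_real (\<rho> * real K + 1) * (complex_of_real (Omega (Re c)) + \<i> * complex_of_real (Omega (Im c)))"
proof -
  interpret prob_space M by fact
  have [measurable]: "Y \<in> borel_measurable M" using assms(2) by (simp add: cgauss_def)
  have int: "integrable M (\<lambda>\<omega>. complex_of_real (sgn (f \<omega>) * sgn (g \<omega>)))"
    if [measurable]: "f \<in> borel_measurable M" "g \<in> borel_measurable M" for f g :: "'w \<Rightarrow> real"
    by (rule integrable_const_bound[where B = 1]) (auto simp: abs_mult sgn_if)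
  have meas: "(\<lambda>\<omega>. Re (Y \<omega> $ l)) \<in> borel_measurable M" "(\<lambda>\<omega>. Im (Y \<omega> $ l)) \<in> borel_measurable M"
    "(\<lambda>\<omega>. - Im (Y \<omega> $ l)) \<in> borel_measurable M" for l
    by measurable
  note corr = cgauss_sign_correlation[OF assms(1-3) pos]
  have "(\<integral>\<omega>. quant \<rho> K (Y \<omega> $ i) * cnj (quant \<rho> K (Y \<omega> $ j)) \<partial>M) = complex_of_real ((\<rho> * real K + 1) / 2) *
    (complex_of_real (\<integral>\<omega>. sgn (Re (Y \<omega> $ i)) * sgn (Re (Y \<omega> $ j)) \<partial>M) + complex_of_real (\<integral>\<omega>. sgn (Im (Y \<omega> $ i)) * sgn (Im (Y \<omega> $ j)) \<partial>M)
     + \<i> * (complex_of_real (\<integral>\<omega>. sgn (Im (Y \<omega> $ i)) * sgn (Re (Y \<omega> $ j)) \<partial>M)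
          + complex_of_real (\<integral>\<omega>. sgn (Re (Y \<omega> $ i)) * sgn (- Im (Y \<omega> $ j)) \<partial>M)))"
    unfolding quant_mult_cnj[OF \<open>0 \<le> \<rho>\<close>] integral_complex_of_real[symmetric]
    by (simp only: integral_mult_right_zero Bochner_Integration.integral_add Bochner_Integration.integrable_add
        integrable_mult_right int meas)
  also have "(\<integral>\<omega>. sgn (Re (Y \<omega> $ i)) * sgn (Re (Y \<omega> $ j)) \<partial>M) = Omega (Re c)"
    using corr[of 1 1] by (simp add: c_def)
  also have "(\<integral>\<omega>. sgn (Im (Y \<omega> $ i)) * sgn (Im (Y \<omega> $ j)) \<partial>M) = Omega (Re c)"
    using corr[of \<i> \<i>] by (simp add: c_def)
  also have "(\<integral>\<omega>. sgn (Im (Y \<omega> $ i)) * sgn (Re (Y \<omega> $ j)) \<partial>M) = Omega (Im c)"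
    using corr[of \<i> 1] by (simp add: c_def)
  also have "(\<integral>\<omega>. sgn (Re (Y \<omega> $ i)) * sgn (- Im (Y \<omega> $ j)) \<partial>M) = Omega (Im c)"
    using corr[of 1 "- \<i>"] by (simp add: c_def)
  finally show ?thesis
    by (simp add: mult_2[symmetric] distrib_left[of 2, symmetric] mult.left_commute[of \<i> 2] del: distrib_left_numeral)
qed

section \<open>The stacked received signal\<close>

lemma prod_UNIV_option:
  "(\<Prod>i\<in>UNIV. f i) = f None * (\<Prod>i\<in>UNIV. f (Some (i :: 'a::finite)))"
  by (simp add: UNIV_option_conv prod.reindex)

text \<open>Channels and noises have different value types, so \<open>mutually_indep\<close> is
  stated through set systems. Composed with complex-valued functions they become one family
  \<open>X\<close> over \<open>'k option option\<close>, to which the product rule for independent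
  variables applies.\<close>

lemma mutually_indep_integral_prod:
  fixes h :: "'k::finite \<Rightarrow> 'w \<Rightarrow> complex^'m::finite" and Zp :: "'w \<Rightarrow> complex^'t::finite^'m" and z :: "'w \<Rightarrow> complex^'m"
    and e :: "complex^'m \<Rightarrow> complex" and f :: "'k \<Rightarrow> complex^'m \<Rightarrow> complex" and g :: "complex^'t^'m \<Rightarrow> complex"
  assumes "prob_space M" "mutually_indep M h Zp z"
    and [measurable]: "\<And>k. h k \<in> borel_measurable M" "Zp \<in> borel_measurable M" "z \<in> borel_measurable M"
    and [measurable]: "\<And>k. f k \<in> borel_measurable borel" "g \<in> borel_measurable borel" "e \<in> borel_measurable borel"
    and int: "\<And>k. integrable M (\<lambda>\<omega>. f k (h k \<omega>))" "integrable M (\<lambda>\<omega>. g (Zp \<omega>))" "integrable M (\<lambda>\<omega>. e (z \<omega>))"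
  shows "(\<integral>\<omega>. e (z \<omega>) * (g (Zp \<omega>) * (\<Prod>k\<in>UNIV. f k (h k \<omega>))) \<partial>M)
    = (\<integral>\<omega>. e (z \<omega>) \<partial>M) * ((\<integral>\<omega>. g (Zp \<omega>) \<partial>M) * (\<Prod>k\<in>UNIV. \<integral>\<omega>. f k (h k \<omega>) \<partial>M))"
proof -
  interpret prob_space M by fact
  define X where "X i = (case i of Some (Some k) \<Rightarrow> (\<lambda>\<omega>. f k (h k \<omega>)) | Some None \<Rightarrow> (\<lambda>\<omega>. g (Zp \<omega>)) | None \<Rightarrow> (\<lambda>\<omega>. e (z \<omega>)))"
    for i :: "'k option option"
  \<comment> \<open>Composition with a Borel function only shrinks the generated set system, so
    independence is inherited by \<open>X\<close>.\<close>
  have pre: "\<exists>B. (\<lambda>\<omega>. \<phi> (Y \<omega>)) -` A \<inter> space M = Y -` B \<inter> space M \<and> B \<in> sets borel"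
    if "\<phi> \<in> borel_measurable borel" "A \<in> sets borel" for \<phi> :: "'x::topological_space \<Rightarrow> complex" and Y :: "'w \<Rightarrow> 'x" and A
    using measurable_sets_borel[OF that] by (intro exI[of _ "\<phi> -` A"]) auto
  have "indep_vars (\<lambda>_. borel) X UNIV"
    unfolding indep_vars_def2
  proof (intro conjI ballI)
    show "random_variable borel (X i)" for i
      by (auto simp: X_def split: option.split)
    show "indep_sets (\<lambda>i. {X i -` A \<inter> space M |A. A \<in> sets borel}) UNIV"
      using assms(2) unfolding mutually_indep_def
    proof (rule indep_sets_mono_sets)
      fix i :: "'k option option"
      show "{X i -` A \<inter> space M |A. A \<in> sets borel} \<subseteq> (case i of
          Some (Some k) \<Rightarrow> {h k -` A \<inter> space M |A. A \<in> sets borel}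
        | Some None \<Rightarrow> {Zp -` A \<inter> space M |A. A \<in> sets borel}
        | None \<Rightarrow> {z -` A \<inter> space M |A. A \<in> sets borel})"
        by (auto simp: X_def split: option.split intro!: pre)
    qed
  qed
  then have "(\<integral>\<omega>. (\<Prod>i\<in>UNIV. X i \<omega>) \<partial>M) = (\<Prod>i\<in>UNIV. \<integral>\<omega>. X i \<omega> \<partial>M)"
  proof (intro indep_vars_lebesgue_integral)
    show "integrable M (X i)" for i
      using int by (auto simp: X_def split: option.split)
  qed auto
  then show ?thesis
    by (simp add: prod_UNIV_option X_def)
qed

lemma indep_cgauss1_char:
  fixes Z :: "'i::finite \<Rightarrow> 'w \<Rightarrow> complex"
  assumes "prob_space M" "prob_space.indep_vars M (\<lambda>_. borel) Z UNIV" "\<And>i. cgauss1 M (Z i) 1"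
  shows "(\<integral>\<omega>. cis (Re (\<Sum>i\<in>UNIV. cnj (b i) * Z i \<omega>)) \<partial>M) = exp (- (\<Sum>i\<in>UNIV. cnj (b i) * b i) / 4)"
proof -
  interpret prob_space M by fact
  have [measurable]: "Z i \<in> borel_measurable M" for i
    using assms(3) by (simp add: cgauss1_def)
  have "indep_vars (\<lambda>_. borel) (\<lambda>i \<omega>. cis (Re (cnj (b i) * Z i \<omega>))) UNIV"
    by (rule indep_vars_compose2[OF assms(2)]) measurable
  then have "(\<integral>\<omega>. (\<Prod>i\<in>UNIV. cis (Re (cnj (b i) * Z i \<omega>))) \<partial>M) = (\<Prod>i\<in>UNIV. \<integral>\<omega>. cis (Re (cnj (b i) * Z i \<omega>)) \<partial>M)"
    by (intro indep_vars_lebesgue_integral integrable_cis_Re prob_space_axioms) auto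
  also have "\<dots> = (\<Prod>i\<in>UNIV. exp (- (cnj (b i) * b i) / 4))"
  proof (intro prod.cong refl)
    fix i
    have "(\<integral>\<omega>. cis (Re (cnj (b i) * Z i \<omega>)) \<partial>M) = complex_of_real (exp (- (1 * (cmod (b i))\<^sup>2) / 4))"
      using assms(3)[of i] unfolding cgauss1_def by blast
    also have "\<dots> = exp (- complex_of_real ((cmod (b i))\<^sup>2) / 4)"
      by (simp add: exp_of_real[symmetric])
    finally show "(\<integral>\<omega>. cis (Re (cnj (b i) * Z i \<omega>)) \<partial>M) = exp (- (cnj (b i) * b i) / 4)"
      by (simp only: complex_norm_square mult.commute)
  qed
  also have "\<dots> = exp (- (\<Sum>i\<in>UNIV. cnj (b i) * b i) / 4)"
    by (simp add: exp_sum[symmetric] sum_negf sum_divide_distrib)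
  finally show ?thesis
    by (simp only: Re_sum cis_sum finite)
qed

text \<open>Several stacked samples share an antenna; with \<open>a = antenna\<close> this converts
  a sum over antennas into a sum over samples.\<close>

lemma sum_fibres:
  fixes c :: "'i::finite \<Rightarrow> 'a::comm_semiring_0"
  shows "(\<Sum>m\<in>UNIV. (\<Sum>i | a i = m. c i) * f m) = (\<Sum>i\<in>UNIV. c i * f (a i :: 'm::finite))"
proof -
  have "(\<Sum>m\<in>UNIV. (\<Sum>i | a i = m. c i) * f m) = (\<Sum>m\<in>UNIV. \<Sum>i | i \<in> UNIV \<and> a i = m. c i * f (a i))"
    by (simp add: sum_distrib_right)
  also have "\<dots> = (\<Sum>i\<in>UNIV. c i * f (a i))"
    by (rule sum.group) auto
  finally show ?thesis .
qed

text \<open>The pilot observation and the data observation are stacked into one vector with index type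
  \<open>('t \<times> 'm) + 'm\<close>. Entry \<open>i\<close> is \<open>sqrt \<rho> * (\<Sum>k. cnj (weight P x k i) * H $ antenna i $ k)\<close> plus noise.\<close>

definition antenna :: "('t \<times> 'm) + 'm \<Rightarrow> 'm" where
  "antenna i = (case i of Inl p \<Rightarrow> snd p | Inr m \<Rightarrow> m)"

text \<open>Weights enter conjugated, in accordance with \<open>mconj (Pbar P)\<close> in
  \<open>yp\<close>. The data symbol is therefore stored as its conjugate.\<close>

definition weight :: "complex^'k::finite^'t::finite \<Rightarrow> complex^'k \<Rightarrow> 'k \<Rightarrow> ('t \<times> 'm) + 'm \<Rightarrow> complex" where
  "weight P x k i = (case i of Inl p \<Rightarrow> P $ fst p $ k | Inr m \<Rightarrow> cnj (x $ k))"

definition received :: "real \<Rightarrow> complex^'k::finite^'t::finite \<Rightarrow> complex^'k \<Rightarrow> complex^'k^'m::finite \<Rightarrow> complex^'t^'m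
    \<Rightarrow> complex^'m \<Rightarrow> complex^(('t \<times> 'm) + 'm)" where
  "received \<rho> P x Hm Zpm zv = (\<chi> i. case i of Inl p \<Rightarrow> yp \<rho> P Hm Zpm $ p | Inr m \<Rightarrow> (sqrt \<rho> *\<^sub>R (Hm *v x) + zv) $ m)"

definition received_cov :: "real \<Rightarrow> ('k::finite \<Rightarrow> complex^'m::finite^'m) \<Rightarrow> complex^'k^'t::finite \<Rightarrow> complex^'k
    \<Rightarrow> complex^(('t \<times> 'm) + 'm)^(('t \<times> 'm) + 'm)" where
  "received_cov \<rho> C P x = (\<chi> i j. complex_of_real \<rho> *
     (\<Sum>k\<in>UNIV. cnj (weight P x k i) * C k $ antenna i $ antenna j * weight P x k j) + (if i = j then 1 else 0))"

lemma yp_nth: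
  "yp \<rho> P Hm Zpm $ (u, m) = complex_of_real (sqrt \<rho>) * (\<Sum>k\<in>UNIV. cnj (P $ u $ k) * Hm $ m $ k) + Zpm $ m $ u"
proof -
  have "(mconj (Pbar P) *v vecm Hm) $ (u, m) = (\<Sum>k\<in>UNIV. \<Sum>n\<in>UNIV. cnj (P $ u $ k * (if m = n then 1 else 0)) * Hm $ n $ k)"
    by (simp add: matrix_vector_mult_def mconj_def Pbar_def kron_def vecm_def mat_def sum.cartesian_product case_prod_beta)
  also have "\<dots> = (\<Sum>k\<in>UNIV. cnj (P $ u $ k) * Hm $ m $ k)"
    by (simp add: if_distrib[of cnj] if_distrib[of "\<lambda>c. c * _"] if_distrib[of "\<lambda>c. _ * c"] cong: if_cong)
  finally show ?thesis
    by (simp add: yp_def vecm_def scaleR_conv_of_real[where 'a = complex])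
qed

lemma received_nth:
  "received \<rho> P x Hm Zpm zv $ i = complex_of_real (sqrt \<rho>) * (\<Sum>k\<in>UNIV. cnj (weight P x k i) * Hm $ antenna i $ k)
     + (case i of Inl p \<Rightarrow> Zpm $ snd p $ fst p | Inr m \<Rightarrow> zv $ m)"
  by (cases i)
     (auto simp: received_def weight_def antenna_def yp_nth matrix_vector_mult_def
       scaleR_conv_of_real[where 'a = complex] mult.commute)

lemma sum_UNIV_Plus:
  "(\<Sum>i\<in>UNIV. f i) = (\<Sum>i\<in>UNIV. f (Inl i :: 'a::finite + 'b::finite)) + (\<Sum>i\<in>UNIV. f (Inr i))"
  by (simp add: UNIV_Plus_UNIV[symmetric] sum.Plus del: UNIV_Plus_UNIV)

text \<open>A linear functional of the stacked vector splits into functionals of \<open>z\<close>,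
  of \<open>Zp\<close> and of each channel column. Independence factorizes its characteristic
  function, and the Gaussian exponents add up to the quadratic form of
  \<open>received_cov\<close>.\<close>

lemma cgauss_received:
  fixes C :: "'k::finite \<Rightarrow> complex^'m::finite^'m" and P :: "complex^'k^'t::finite"
  assumes "prob_space M" "0 \<le> \<rho>"
    and H [measurable]: "H \<in> borel_measurable M"
    and h: "\<And>k. cgauss M (\<lambda>\<omega>. column_of k (H \<omega>)) (C k)"
    and Zp1: "\<And>u m. cgauss1 M (\<lambda>\<omega>. Zp \<omega> $ m $ u) 1"
    and Zpi: "prob_space.indep_vars M (\<lambda>_. borel) (\<lambda>(i::'t \<times> 'm) \<omega>. Zp \<omega> $ snd i $ fst i) UNIV"
    and z: "cgauss M z (mat 1)"
    and Zp [measurable]: "Zp \<in> borel_measurable M"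
    and ind: "mutually_indep M (\<lambda>k \<omega>. column_of k (H \<omega>)) Zp z"
  shows "cgauss M (\<lambda>\<omega>. received \<rho> P x (H \<omega>) (Zp \<omega>) (z \<omega>)) (received_cov \<rho> C P x)"
  unfolding cgauss_def
proof (intro conjI allI)
  interpret prob_space M by fact
  have z_meas [measurable]: "z \<in> borel_measurable M" and h_meas: "(\<lambda>\<omega>. column_of k (H \<omega>)) \<in> borel_measurable M" for k
    using z h by (auto simp: cgauss_def)
  show "(\<lambda>\<omega>. received \<rho> P x (H \<omega>) (Zp \<omega>) (z \<omega>)) \<in> borel_measurable M"
  proof (rule borel_measurable_euclidean_space[THEN iffD2], intro ballI)
    fix b :: "complex^(('t \<times> 'm) + 'm)"
    show "(\<lambda>\<omega>. received \<rho> P x (H \<omega>) (Zp \<omega>) (z \<omega>) \<bullet> b) \<in> borel_measurable M"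
      unfolding inner_vec_def received_nth
    proof (intro borel_measurable_sum borel_measurable_inner borel_measurable_add)
      show "(\<lambda>\<omega>. case i of Inl p \<Rightarrow> Zp \<omega> $ snd p $ fst p | Inr m \<Rightarrow> z \<omega> $ m) \<in> borel_measurable M" for i
        by (cases i) simp_all
    qed measurable
  qed
  fix t :: "complex^(('t \<times> 'm) + 'm)"
  define s where "s = complex_of_real (sqrt \<rho>)"
  have s: "cnj s = s" "s * s = complex_of_real \<rho>"
    using \<open>0 \<le> \<rho>\<close> by (simp_all add: s_def of_real_mult[symmetric] del: of_real_mult)
  let ?w = "weight P x :: 'k \<Rightarrow> ('t \<times> 'm) + 'm \<Rightarrow> complex"
  \<comment> \<open>\<open>a k\<close> is the image of the test vector \<open>t\<close> under the
    adjoint of the map sending channel \<open>k\<close> to its contribution to the stacked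
    signal.\<close>
  define a :: "'k \<Rightarrow> complex^'m" where "a k = (\<chi> m. s * (\<Sum>i | antenna i = m. t $ i * ?w k i))" for k
  have cnj_a: "(\<Sum>m\<in>UNIV. cnj (a k $ m) * f m) = s * (\<Sum>i\<in>UNIV. cnj (t $ i) * cnj (?w k i) * f (antenna i))" for k f
  proof -
    have "(\<Sum>m\<in>UNIV. cnj (a k $ m) * f m) = s * (\<Sum>m\<in>UNIV. (\<Sum>i | antenna i = m. cnj (t $ i) * cnj (?w k i)) * f m)"
      by (simp add: a_def s sum_distrib_left[symmetric] mult.assoc)
    then show ?thesis unfolding sum_fibres .
  qed
  have a: "(\<Sum>m\<in>UNIV. f m * a k $ m) = s * (\<Sum>i\<in>UNIV. f (antenna i) * (t $ i * ?w k i))" for k f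
  proof -
    have "(\<Sum>m\<in>UNIV. f m * a k $ m) = s * (\<Sum>m\<in>UNIV. (\<Sum>i | antenna i = m. t $ i * ?w k i) * f m)"
      by (simp add: a_def sum_distrib_left mult_ac)
    then show ?thesis unfolding sum_fibres by (simp add: mult_ac)
  qed
  define e where "e v = cis (Re (\<Sum>m\<in>UNIV. cnj (t $ Inr m) * v $ m))" for v :: "complex^'m"
  define g where "g B = cis (Re (\<Sum>p\<in>UNIV. cnj (t $ Inl p) * B $ snd p $ fst p))" for B :: "complex^'t^'m"
  define f where "f k v = cis (Re (\<Sum>m\<in>UNIV. cnj (a k $ m) * v $ m))" for k and v :: "complex^'m"
  have meas: "e \<in> borel_measurable borel" "g \<in> borel_measurable borel" "f k \<in> borel_measurable borel" for k
    unfolding e_def[abs_def] g_def[abs_def] f_def[abs_def] by measurable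
  have lin: "(\<Sum>i\<in>UNIV. cnj (t $ i) * received \<rho> P x (H \<omega>) (Zp \<omega>) (z \<omega>) $ i) =
      (\<Sum>m\<in>UNIV. cnj (t $ Inr m) * z \<omega> $ m) + ((\<Sum>p\<in>UNIV. cnj (t $ Inl p) * Zp \<omega> $ snd p $ fst p)
      + (\<Sum>k\<in>UNIV. \<Sum>m\<in>UNIV. cnj (a k $ m) * column_of k (H \<omega>) $ m))" for \<omega>
  proof -
    have "(\<Sum>k\<in>UNIV. \<Sum>m\<in>UNIV. cnj (a k $ m) * column_of k (H \<omega>) $ m)
      = (\<Sum>k\<in>UNIV. \<Sum>i\<in>UNIV. s * (cnj (t $ i) * cnj (?w k i) * H \<omega> $ antenna i $ k))"
      by (simp add: cnj_a column_of_def sum_distrib_left)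
    also have "\<dots> = (\<Sum>i\<in>UNIV. \<Sum>k\<in>UNIV. s * (cnj (t $ i) * cnj (?w k i) * H \<omega> $ antenna i $ k))"
      by (rule sum.swap)
    also have "\<dots> = (\<Sum>i\<in>UNIV. cnj (t $ i) * (s * (\<Sum>k\<in>UNIV. cnj (?w k i) * H \<omega> $ antenna i $ k)))"
      by (simp add: sum_distrib_left mult_ac)
    finally show ?thesis
      unfolding received_nth s_def[symmetric] distrib_left sum.distrib
      by (simp add: sum_UNIV_Plus[of "\<lambda>i. cnj (t $ i) * (case i of Inl p \<Rightarrow> _ p | Inr m \<Rightarrow> _ m)"])
  qed
  have quad: "(\<Sum>i\<in>UNIV. \<Sum>j\<in>UNIV. cnj (t $ i) * received_cov \<rho> C P x $ i $ j * t $ j) =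
      (\<Sum>m\<in>UNIV. cnj (t $ Inr m) * t $ Inr m) + ((\<Sum>p\<in>UNIV. cnj (t $ Inl p) * t $ Inl p)
      + (\<Sum>k\<in>UNIV. \<Sum>m\<in>UNIV. \<Sum>n\<in>UNIV. cnj (a k $ m) * C k $ m $ n * a k $ n))"
  proof -
    have "(\<Sum>k\<in>UNIV. \<Sum>m\<in>UNIV. \<Sum>n\<in>UNIV. cnj (a k $ m) * C k $ m $ n * a k $ n) =
       (\<Sum>k\<in>UNIV. \<Sum>m\<in>UNIV. cnj (a k $ m) * (\<Sum>n\<in>UNIV. C k $ m $ n * a k $ n))"
      by (simp add: sum_distrib_left mult.assoc)
    also have "\<dots> = (\<Sum>k\<in>UNIV. s * s * (\<Sum>i\<in>UNIV. \<Sum>j\<in>UNIV. cnj (t $ i) * (cnj (?w k i) * C k $ antenna i $ antenna j * ?w k j) * t $ j))"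
      unfolding cnj_a a by (simp add: sum_distrib_left mult_ac)
    also have "\<dots> = (\<Sum>k\<in>UNIV. \<Sum>i\<in>UNIV. \<Sum>j\<in>UNIV. complex_of_real \<rho> * (cnj (t $ i) * (cnj (?w k i) * C k $ antenna i $ antenna j * ?w k j) * t $ j))"
      by (simp add: s sum_distrib_left)
    also have "\<dots> = (\<Sum>i\<in>UNIV. \<Sum>j\<in>UNIV. \<Sum>k\<in>UNIV. complex_of_real \<rho> * (cnj (t $ i) * (cnj (?w k i) * C k $ antenna i $ antenna j * ?w k j) * t $ j))"
      by (subst sum.swap, intro sum.cong refl, rule sum.swap)
    also have "\<dots> = (\<Sum>i\<in>UNIV. \<Sum>j\<in>UNIV. cnj (t $ i) * (complex_of_real \<rho> * (\<Sum>k\<in>UNIV. cnj (?w k i) * C k $ antenna i $ antenna j * ?w k j)) * t $ j)"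
      by (simp add: sum_distrib_left sum_distrib_right mult_ac)
    finally have main: "(\<Sum>k\<in>UNIV. \<Sum>m\<in>UNIV. \<Sum>n\<in>UNIV. cnj (a k $ m) * C k $ m $ n * a k $ n) = \<dots>" .
    have diag: "(\<Sum>i\<in>UNIV. \<Sum>j\<in>UNIV. cnj (t $ i) * (if i = j then 1 else 0) * t $ j) = (\<Sum>i\<in>UNIV. cnj (t $ i) * t $ i)"
      by (simp add: if_distrib[of "\<lambda>c. c * _"] if_distrib[of "\<lambda>c. _ * c"] cong: if_cong)
    show ?thesis
      unfolding main received_cov_def vec_lambda_beta distrib_left distrib_right sum.distrib diag
      by (simp add: sum_UNIV_Plus[of "\<lambda>i. cnj (t $ i) * t $ i"])
  qed
  have "(\<integral>\<omega>. cis (Re (\<Sum>i\<in>UNIV. cnj (t $ i) * received \<rho> P x (H \<omega>) (Zp \<omega>) (z \<omega>) $ i)) \<partial>M)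
      = (\<integral>\<omega>. e (z \<omega>) * (g (Zp \<omega>) * (\<Prod>k\<in>UNIV. f k (column_of k (H \<omega>)))) \<partial>M)"
    unfolding lin e_def g_def f_def plus_complex.sel Re_sum[of _ UNIV] cis_mult[symmetric] cis_sum[OF finite] ..
  also have "\<dots> = (\<integral>\<omega>. e (z \<omega>) \<partial>M) * ((\<integral>\<omega>. g (Zp \<omega>) \<partial>M) * (\<Prod>k\<in>UNIV. \<integral>\<omega>. f k (column_of k (H \<omega>)) \<partial>M))"
  proof (intro mutually_indep_integral_prod[OF \<open>prob_space M\<close> ind] Zp z_meas h_meas meas)
    note [measurable] = h_meas
    show "integrable M (\<lambda>\<omega>. f k (column_of k (H \<omega>)))" "integrable M (\<lambda>\<omega>. g (Zp \<omega>))"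
      "integrable M (\<lambda>\<omega>. e (z \<omega>))" for k
      unfolding e_def g_def f_def by (rule integrable_cis_Re[OF \<open>prob_space M\<close>], measurable)+
  qed
  also have "(\<integral>\<omega>. e (z \<omega>) \<partial>M) = exp (- (\<Sum>m\<in>UNIV. cnj (t $ Inr m) * t $ Inr m) / 4)"
  proof -
    have "(\<integral>\<omega>. e (z \<omega>) \<partial>M) = exp (- (\<Sum>i\<in>UNIV. \<Sum>j\<in>UNIV. cnj ((\<chi> m. t $ Inr m) $ i) * mat 1 $ i $ j * (\<chi> m. t $ Inr m) $ j) / 4)"
      using z[unfolded cgauss_def, THEN conjunct2, THEN spec, of "\<chi> m. t $ Inr m"] by (simp add: e_def)
    then show ?thesis
      by (simp add: mat_def if_distrib[of "\<lambda>c. c * _"] if_distrib[of "\<lambda>c. _ * c"] cong: if_cong)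
  qed
  also have "(\<integral>\<omega>. g (Zp \<omega>) \<partial>M) = exp (- (\<Sum>p\<in>UNIV. cnj (t $ Inl p) * t $ Inl p) / 4)"
    unfolding g_def by (rule indep_cgauss1_char[OF \<open>prob_space M\<close> Zpi Zp1])
  also have "(\<Prod>k\<in>UNIV. \<integral>\<omega>. f k (column_of k (H \<omega>)) \<partial>M)
     = exp (- (\<Sum>k\<in>UNIV. \<Sum>m\<in>UNIV. \<Sum>n\<in>UNIV. cnj (a k $ m) * C k $ m $ n * a k $ n) / 4)"
    using h unfolding f_def cgauss_def by (simp add: exp_sum[symmetric] sum_negf sum_divide_distrib)
  finally show "(\<integral>\<omega>. cis (Re (\<Sum>i\<in>UNIV. cnj (t $ i) * received \<rho> P x (H \<omega>) (Zp \<omega>) (z \<omega>) $ i)) \<partial>M)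
     = exp (- (\<Sum>i\<in>UNIV. \<Sum>j\<in>UNIV. cnj (t $ i) * received_cov \<rho> C P x $ i $ j * t $ j) / 4)"
    by (simp only: quad exp_add[symmetric] add_divide_distrib minus_add_distrib)
qed

lemma hermitian_received_cov:
  assumes "\<And>k. hermitian (C k)"
  shows "hermitian (received_cov \<rho> C P x)"
proof -
  have "cnj (C k $ j $ i) = C k $ i $ j" for k i j
    using assms[of k] unfolding hermitian_def by metis
  then show ?thesis
    by (auto simp: hermitian_def received_cov_def mult_ac)
qed

lemma psd_diag:
  assumes "psd C"
  shows "C $ m $ m = complex_of_real (Re (C $ m $ m))" "0 \<le> Re (C $ m $ m)"
proof -
  have "C $ m $ m = cnj (C $ m $ m)"
    using assms unfolding psd_def hermitian_def by blast
  from arg_cong[OF this, of Im] show "C $ m $ m = complex_of_real (Re (C $ m $ m))"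
    by (simp add: complex_eq_iff)
  have "0 \<le> Re (\<Sum>i\<in>UNIV. \<Sum>j\<in>UNIV. cnj (axis m 1 $ i) * C $ i $ j * axis m 1 $ j)"
    using assms unfolding psd_def by blast
  also have "(\<Sum>i\<in>UNIV. \<Sum>j\<in>UNIV. cnj (axis m 1 $ i) * C $ i $ j * axis m 1 $ j) = C $ m $ m"
    by (simp add: axis_def if_distrib[of cnj] if_distrib[of "\<lambda>c. c * _"] if_distrib[of "\<lambda>c. _ * c"] cong: if_cong)
  finally show "0 \<le> Re (C $ m $ m)" .
qed

section \<open>Mean of the MRC symbol estimate\<close>

lemma ctrans_nth: "ctrans A $ i $ j = cnj (A $ j $ i)"
  by (simp add: ctrans_def mconj_def transpose_def)

lemma ctrans_matrix_mul: "ctrans (A ** B) = ctrans B ** ctrans A"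
  by (simp add: vec_eq_iff ctrans_nth matrix_matrix_mult_def mult.commute)

lemma ctrans_hermitian: "hermitian A \<Longrightarrow> ctrans A = A"
  unfolding hermitian_def vec_eq_iff ctrans_nth by metis

lemma ctrans_mat_1: "ctrans (mat 1) = mat 1"
  by (simp add: vec_eq_iff ctrans_nth mat_def)

lemma matrix_mul_matrix_inv:
  assumes "invertible A"
  shows "A ** matrix_inv A = mat 1"
  using assms unfolding invertible_def matrix_inv_def by (rule someI2_ex) simp

text \<open>Conjugate-transposing \<open>A ** matrix_inv A = mat 1\<close> shows that
  \<open>ctrans (matrix_inv A)\<close> is a left inverse of \<open>A\<close>, and a left inverse
  coincides with a right inverse.\<close>

lemma ctrans_matrix_inv_hermitian:
  assumes "hermitian A" "invertible A"
  shows "ctrans (matrix_inv A) = matrix_inv A"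
proof -
  have "ctrans (matrix_inv A) ** A = ctrans (A ** matrix_inv A)"
    by (simp add: ctrans_matrix_mul ctrans_hermitian assms)
  also have "\<dots> = mat 1"
    using assms by (simp add: matrix_mul_matrix_inv ctrans_mat_1)
  finally have "ctrans (matrix_inv A) ** (A ** matrix_inv A) = matrix_inv A"
    by (simp only: matrix_mul_assoc matrix_mul_lid)
  then show ?thesis
    using assms by (simp add: matrix_mul_matrix_inv)
qed

lemma norm_quant_le: "cmod (quant \<rho> K c) \<le> \<bar>sqrt ((\<rho> * real K + 1) / 2)\<bar> * 2"
proof -
  have "cmod (complex_of_real (sgn (Re c)) + \<i> * complex_of_real (sgn (Im c))) \<le> 1 + 1"
    by (intro order_trans[OF norm_triangle_ineq] add_mono) (auto simp: norm_mult sgn_if)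
  then show ?thesis
    unfolding quant_def norm_mult norm_of_real by (intro mult_left_mono) auto
qed

lemma borel_measurable_cnj [measurable]: "cnj \<in> borel_measurable borel"
  by (intro borel_measurable_continuous_onI continuous_intros)

lemma borel_measurable_quant [measurable]: "quant \<rho> K \<in> borel_measurable borel"
  unfolding quant_def[abs_def] by measurable

text \<open>In the pilot equation \<open>x\<close> and \<open>zv\<close> are arbitrary, so pilot and
  data samples can be read off the same stacked vector.\<close>

lemma quantized_received:
  "rp \<rho> P Hm Zpm $ p = quant \<rho> CARD('k) (received \<rho> (P :: complex^'k::finite^'t::finite) x Hm Zpm zv $ Inl p)"
  "rdata \<rho> Hm zv x $ m = quant \<rho> CARD('k) (received \<rho> P x Hm Zpm zv $ Inr m)"
  by (simp_all add: rp_def rdata_def received_def)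

lemma hermitian_Crp_of: "hermitian (Crp_of M \<rho> P H Zp)"
  unfolding hermitian_def Crp_of_def vec_lambda_beta
  by (simp add: Bochner_Integration.integral_cnj[symmetric] mult.commute del: Bochner_Integration.integral_cnj)

lemma MRC_mean_trace:
  fixes P :: "complex^'k::finite^'t::finite" and C :: "'k \<Rightarrow> complex^'m::finite^'m"
  assumes "prob_space M" and Y: "(\<lambda>\<omega>. received \<rho> P x (H \<omega>) (Zp \<omega>) (z \<omega>)) \<in> borel_measurable M"
    and herm: "hermitian (C k)" and inv: "invertible (Crp_of M \<rho> P H Zp)"
  shows "EMRC M \<rho> P C x H Zp z k = complex_of_real (sqrt \<rho>) *
    trace (matrix_inv (Crp_of M \<rho> P H Zp) ** Ap \<rho> P C ** mconj (Pbark P k) ** C k ** Crrp_of M \<rho> P x H Zp z)"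
proof -
  interpret prob_space M by fact
  let ?R = "Crp_of M \<rho> P H Zp"
  \<comment> \<open>\<open>D\<close> is the estimator matrix: the channel estimate is
    \<open>sqrt \<rho>\<close> times \<open>D\<close> applied to \<open>rp\<close>. Conjugating the
    estimate in the inner product turns the mean into a trace against \<open>ctrans D\<close>, which
    reverses the factors.\<close>
  define D where "D = C k ** transpose (Pbark P k) ** Ap \<rho> P C ** matrix_inv ?R"
  have "ctrans (Ap \<rho> P C) = Ap \<rho> P C"
    by (simp add: vec_eq_iff ctrans_nth Ap_def)
  moreover have "ctrans (transpose (Pbark P k)) = mconj (Pbark P k :: complex^'m^('t \<times> 'm))"
    by (simp add: vec_eq_iff ctrans_nth mconj_def transpose_def)
  ultimately have D: "ctrans D = matrix_inv ?R ** Ap \<rho> P C ** mconj (Pbark P k) ** C k"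
    using inv herm hermitian_Crp_of[of M \<rho> P H Zp]
    by (simp add: D_def ctrans_matrix_mul ctrans_matrix_inv_hermitian ctrans_hermitian matrix_mul_assoc)
  have q: "rp \<rho> P (H \<omega>) (Zp \<omega>) $ p = quant \<rho> CARD('k) (received \<rho> P x (H \<omega>) (Zp \<omega>) (z \<omega>) $ Inl p)"
    "rdata \<rho> (H \<omega>) (z \<omega>) x $ m = quant \<rho> CARD('k) (received \<rho> P x (H \<omega>) (Zp \<omega>) (z \<omega>) $ Inr m)" for \<omega> p m
    by (rule quantized_received)+
  have int: "integrable M (\<lambda>\<omega>. rdata \<rho> (H \<omega>) (z \<omega>) x $ m * cnj (rp \<rho> P (H \<omega>) (Zp \<omega>) $ j))" for m j
  proof (rule integrable_const_bound)
    note [measurable] = Y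
    show "(\<lambda>\<omega>. rdata \<rho> (H \<omega>) (z \<omega>) x $ m * cnj (rp \<rho> P (H \<omega>) (Zp \<omega>) $ j)) \<in> borel_measurable M"
      unfolding q by measurable
    show "AE \<omega> in M. norm (rdata \<rho> (H \<omega>) (z \<omega>) x $ m * cnj (rp \<rho> P (H \<omega>) (Zp \<omega>) $ j))
      \<le> (\<bar>sqrt ((\<rho> * real CARD('k) + 1) / 2)\<bar> * 2) * (\<bar>sqrt ((\<rho> * real CARD('k) + 1) / 2)\<bar> * 2)"
      unfolding norm_mult complex_mod_cnj rdata_def rp_def vec_lambda_beta
      by (intro AE_I2 mult_mono norm_quant_le) auto
  qed
  have "EMRC M \<rho> P C x H Zp z k = (\<integral>\<omega>. (\<Sum>m\<in>UNIV. \<Sum>j\<in>UNIV. complex_of_real (sqrt \<rho>) * cnj (D $ m $ j) *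
      (rdata \<rho> (H \<omega>) (z \<omega>) x $ m * cnj (rp \<rho> P (H \<omega>) (Zp \<omega>) $ j))) \<partial>M)"
    unfolding EMRC_def hhat_def D_def[symmetric]
    by (simp add: matrix_vector_mult_def scaleR_conv_of_real[where 'a = complex] sum_distrib_left sum_distrib_right mult_ac)
  also have "\<dots> = (\<Sum>m\<in>UNIV. \<Sum>j\<in>UNIV. complex_of_real (sqrt \<rho>) * cnj (D $ m $ j) * Crrp_of M \<rho> P x H Zp z $ m $ j)"
    using int by (simp add: Bochner_Integration.integral_sum Bochner_Integration.integrable_sum Crrp_of_def)
  also have "\<dots> = complex_of_real (sqrt \<rho>) * trace (ctrans D ** Crrp_of M \<rho> P x H Zp z)"
    unfolding trace_def matrix_matrix_mult_def vec_lambda_beta ctrans_nth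
    by (subst sum.swap) (simp add: sum_distrib_left mult.assoc)
  finally show ?thesis unfolding D .
qed

section \<open>Variances of pilot and data samples\<close>

lemma csqrt_mult_of_real:
  "0 \<le> a \<Longrightarrow> 0 \<le> b \<Longrightarrow> csqrt (complex_of_real a * complex_of_real b) = complex_of_real (sqrt (a * b))"
  by (simp add: of_real_mult[symmetric] csqrt_of_real_nonneg del: of_real_mult)

text \<open>Positive semidefinite matrices have real nonnegative diagonals, and the unit noise
  variance makes the total positive. Hence \<open>csqrt\<close> is an ordinary square root here and
  the arcsine law applies.\<close>

lemma alpha_real:
  assumes "\<And>k. psd (C k)" "0 < \<rho>"
  shows "alpha \<rho> C m = complex_of_real (Re (alpha \<rho> C m))" "0 < Re (alpha \<rho> C m)"
proof -
  have "alpha \<rho> C m = complex_of_real (\<rho> * (\<Sum>k\<in>UNIV. Re (C k $ m $ m)) + 1)"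
    using psd_diag(1)[OF assms(1)] by (simp add: alpha_def mat_def scaleR_conv_of_real[where 'a = complex])
  moreover have "0 \<le> \<rho> * (\<Sum>k\<in>UNIV. Re (C k $ m $ m))"
    using assms by (intro mult_nonneg_nonneg sum_nonneg psd_diag(2)) auto
  ultimately show "alpha \<rho> C m = complex_of_real (Re (alpha \<rho> C m))" "0 < Re (alpha \<rho> C m)"
    by simp_all
qed

lemma beta_real:
  assumes "\<And>k. psd (C k)" "0 < \<rho>"
  shows "beta \<rho> C x m = complex_of_real (Re (beta \<rho> C x m))" "0 < Re (beta \<rho> C x m)"
proof -
  have "beta \<rho> C x m = complex_of_real (\<rho> * (\<Sum>k\<in>UNIV. (cmod (x $ k))\<^sup>2 * Re (C k $ m $ m)) + 1)"
    using psd_diag(1)[OF assms(1)] by (simp add: beta_def mat_def scaleR_conv_of_real[where 'a = complex])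
  moreover have "0 \<le> \<rho> * (\<Sum>k\<in>UNIV. (cmod (x $ k))\<^sup>2 * Re (C k $ m $ m))"
    using assms by (intro mult_nonneg_nonneg sum_nonneg psd_diag(2)) auto
  ultimately show "beta \<rho> C x m = complex_of_real (Re (beta \<rho> C x m))" "0 < Re (beta \<rho> C x m)"
    by simp_all
qed

text \<open>Unit-modulus pilots make the variance independent of the pilot time, which is why
  \<open>alpha\<close> depends on the antenna only.\<close>

lemma received_cov_diag_pilot:
  assumes "\<forall>u k. cmod (P $ u $ k) = 1"
  shows "received_cov \<rho> C P x $ Inl (u, m) $ Inl (u, m) = alpha \<rho> C m"
proof -
  have "cnj (P $ u $ k) * c * P $ u $ k = c" for k c
    using complex_norm_square[of "P $ u $ k"] assms by (simp add: mult_ac)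
  then show ?thesis
    by (simp only: received_cov_def weight_def antenna_def vec_lambda_beta sum.case fst_conv snd_conv)
       (simp add: alpha_def mat_def scaleR_conv_of_real[where 'a = complex])
qed

lemma received_cov_diag_data:
  "received_cov \<rho> C P x $ Inr m $ Inr m = beta \<rho> C x m"
proof -
  have "x $ k * c * cnj (x $ k) = complex_of_real ((cmod (x $ k))\<^sup>2) * c" for k c
    by (simp add: complex_norm_square mult_ac del: of_real_power)
  then show ?thesis
    by (simp only: received_cov_def weight_def antenna_def vec_lambda_beta sum.case complex_cnj_cnj)
       (simp add: beta_def mat_def scaleR_conv_of_real[where 'a = complex] del: of_real_power)
qed

lemma Omega_1: "Omega 1 = 1" and Omega_0: "Omega 0 = 0"
  by (simp_all add: Omega_def)

theorem theorem1:
  fixes Mw :: "'w measure" and \<rho> :: real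
    and P :: "complex^'k::finite^'t::finite"
    and C :: "'k \<Rightarrow> complex^'m::finite^'m"
    and H :: "'w \<Rightarrow> complex^'k^'m"
    and Zp :: "'w \<Rightarrow> complex^'t^'m"
    and z :: "'w \<Rightarrow> complex^'m"
    and x :: "complex^'k"
  defines "Crp \<equiv> Crp_of Mw \<rho> P H Zp"
    and "Crrp \<equiv> Crrp_of Mw \<rho> P x H Zp z"
  assumes "prob_space Mw"
    and "\<rho> > 0"
    and "CARD('k) \<le> CARD('t)"
    and "\<forall>u k. cmod (P $ u $ k) = 1"
    and "\<forall>k l. k \<noteq> l \<longrightarrow> (\<Sum>u\<in>UNIV. cnj (P $ u $ k) * P $ u $ l) = 0"
    and "\<forall>k. psd (C k)"
    and "H \<in> borel_measurable Mw"
    and "\<forall>k. cgauss Mw (\<lambda>\<omega>. column_of k (H \<omega>)) (C k)"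
    and "\<forall>u m. cgauss1 Mw (\<lambda>\<omega>. Zp \<omega> $ m $ u) 1"
    and "prob_space.indep_vars Mw (\<lambda>_. borel) (\<lambda>(i::'t \<times> 'm) \<omega>. Zp \<omega> $ snd i $ fst i) UNIV"
    and "cgauss Mw z (mat 1)"
    and "Zp \<in> borel_measurable Mw"
    and "mutually_indep Mw (\<lambda>k \<omega>. column_of k (H \<omega>)) Zp z"
    and "invertible Crp"
  shows "(\<forall>k. EMRC Mw \<rho> P C x H Zp z k = complex_of_real (sqrt \<rho>) *
            trace (matrix_inv Crp ** Ap \<rho> P C ** mconj (Pbark P k) ** C k ** Crrp))
       \<and> (\<forall>m n u v. Crp $ (u, m) $ (v, n) =
            (if m = n \<and> u = v then complex_of_real (\<rho> * real CARD('k) + 1)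
             else complex_of_real (\<rho> * real CARD('k) + 1) *
               (complex_of_real (Omega (Re (zeta \<rho> C P m n u v)))
                - \<i> * complex_of_real (Omega (Im (zeta \<rho> C P m n u v))))))
       \<and> (\<forall>m n u. Crrp $ m $ (u, n) =
            complex_of_real (\<rho> * real CARD('k) + 1) *
              (complex_of_real (Omega (Re (eta \<rho> C P x m n u)))
               + \<i> * complex_of_real (Omega (Im (eta \<rho> C P x m n u)))))"
proof -
  let ?Y = "\<lambda>\<omega>. received \<rho> P x (H \<omega>) (Zp \<omega>) (z \<omega>)"
  let ?S = "received_cov \<rho> C P x"
  let ?K = "complex_of_real (\<rho> * real CARD('k) + 1)"
  have psd: "psd (C k)" and herm: "hermitian (C k)" for k
    using assms by (auto simp: psd_def)
  have Y: "cgauss Mw ?Y ?S"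
    using assms by (intro cgauss_received) auto
  have S: "hermitian ?S"
    using herm by (rule hermitian_received_cov)
  have \<alpha>: "alpha \<rho> C m = complex_of_real (Re (alpha \<rho> C m))" "0 < Re (alpha \<rho> C m)"
    and \<beta>: "beta \<rho> C x m = complex_of_real (Re (beta \<rho> C x m))" "0 < Re (beta \<rho> C x m)" for m
    using alpha_real beta_real psd \<open>\<rho> > 0\<close> by blast+
  note diag = received_cov_diag_pilot[OF \<open>\<forall>u k. cmod (P $ u $ k) = 1\<close>] received_cov_diag_data
  have sqrt_\<alpha>\<alpha>: "csqrt (alpha \<rho> C m * alpha \<rho> C n) = complex_of_real (sqrt (Re (alpha \<rho> C m) * Re (alpha \<rho> C n)))" for m n
    by (subst (1 2) \<alpha>(1), rule csqrt_mult_of_real) (intro less_imp_le \<alpha>(2))+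
  have sqrt_\<alpha>\<beta>: "csqrt (alpha \<rho> C n * beta \<rho> C x m) = complex_of_real (sqrt (Re (beta \<rho> C x m) * Re (alpha \<rho> C n)))" for m n
    by (subst \<alpha>(1), subst \<beta>(1), subst csqrt_mult_of_real)
       (intro less_imp_le \<alpha>(2) \<beta>(2), intro less_imp_le \<alpha>(2) \<beta>(2), simp only: mult.commute)
  have q: "rp \<rho> P (H \<omega>) (Zp \<omega>) $ p = quant \<rho> CARD('k) (?Y \<omega> $ Inl p)"
    "rdata \<rho> (H \<omega>) (z \<omega>) x $ m = quant \<rho> CARD('k) (?Y \<omega> $ Inr m)" for \<omega> p m
    by (rule quantized_received)+
  \<comment> \<open>The normalized covariance is kept as a variable \<open>c\<close>, so that
    \<open>zeta\<close> and \<open>eta\<close> can be substituted for it.\<close>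
  have corr: "(\<integral>\<omega>. quant \<rho> CARD('k) (?Y \<omega> $ i) * cnj (quant \<rho> CARD('k) (?Y \<omega> $ j)) \<partial>Mw) =
      ?K * (complex_of_real (Omega (Re c)) + \<i> * complex_of_real (Omega (Im c)))"
    if "c = ?S $ i $ j / complex_of_real (sqrt (Re (?S $ i $ i) * Re (?S $ j $ j)))" for i j c
  proof -
    have "0 < Re (?S $ i $ i)" for i
      by (cases i) (auto simp: diag \<alpha>(2) \<beta>(2))
    then show ?thesis
      unfolding that using assms(3,4) Y S by (intro cgauss_quant_correlation) auto
  qed
  \<comment> \<open>With the indices swapped the normalized covariance is exactly \<open>zeta\<close>, hence the conjugate.\<close>
  have "Crp $ (u, m) $ (v, n) = cnj (?K * (complex_of_real (Omega (Re c)) + \<i> * complex_of_real (Omega (Im c))))"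
    if "c = ?S $ Inl (v, n) $ Inl (u, m) / complex_of_real (sqrt (Re (alpha \<rho> C n) * Re (alpha \<rho> C m)))" for m n u v c
  proof -
    have "Crp $ (u, m) $ (v, n) = cnj (Crp $ (v, n) $ (u, m))"
      using hermitian_Crp_of[of Mw \<rho> P H Zp] unfolding hermitian_def Crp_def by blast
    then show ?thesis
      using corr[of c "Inl (v, n)" "Inl (u, m)"] that
      by (simp only: Crp_def Crp_of_def vec_lambda_beta diag q)
  qed
  \<comment> \<open>On the diagonal the covariance equals the variance and the quotient is 1;
    \<open>Omega_1\<close> and \<open>Omega_0\<close> then give the separate case of the formula.
    Off the diagonal the noise contributes nothing.\<close>
  moreover have "?S $ Inl (v, n) $ Inl (u, m) / complex_of_real (sqrt (Re (alpha \<rho> C n) * Re (alpha \<rho> C m)))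
      = (if m = n \<and> u = v then 1 else zeta \<rho> C P m n u v)" for m n u v
  proof (cases "m = n \<and> u = v")
    case True
    have "complex_of_real (sqrt (Re (alpha \<rho> C n) * Re (alpha \<rho> C n))) = alpha \<rho> C n"
      using \<alpha>(2)[of n] by (subst (3) \<alpha>(1)) simp
    moreover have "alpha \<rho> C n \<noteq> 0"
      using \<alpha>(2)[of n] by auto
    ultimately show ?thesis
      using True by (simp add: diag)
  next
    case False
    then have "?S $ Inl (v, n) $ Inl (u, m) = complex_of_real \<rho> * (\<Sum>k\<in>UNIV. transpose (C k) $ m $ n * P $ u $ k * cnj (P $ v $ k))"
      by (auto simp: received_cov_def weight_def antenna_def transpose_def mult_ac)
    with False show ?thesis
      unfolding zeta_def sqrt_\<alpha>\<alpha> by (simp only: mult.commute[of "Re (alpha \<rho> C n)"]) simp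
  qed
  ultimately have part2: "Crp $ (u, m) $ (v, n) =
            (if m = n \<and> u = v then ?K
             else ?K *
               (complex_of_real (Omega (Re (zeta \<rho> C P m n u v)))
                - \<i> * complex_of_real (Omega (Im (zeta \<rho> C P m n u v)))))" for m n u v
    by (simp add: Omega_1 Omega_0)
  have part3: "Crrp $ m $ (u, n) = ?K *
              (complex_of_real (Omega (Re (eta \<rho> C P x m n u)))
               + \<i> * complex_of_real (Omega (Im (eta \<rho> C P x m n u))))" for m n u
  proof -
    \<comment> \<open>Here the data sample comes first and its weight is already conjugated, so
      \<open>eta\<close> is the normalized covariance itself and no conjugate appears.\<close>
    have "eta \<rho> C P x m n u = ?S $ Inr m $ Inl (u, n) / complex_of_real (sqrt (Re (?S $ Inr m $ Inr m) * Re (?S $ Inl (u, n) $ Inl (u, n))))"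
      unfolding eta_def diag sqrt_\<alpha>\<beta> by (simp add: received_cov_def weight_def antenna_def mult_ac)
    from corr[OF this] show ?thesis
      by (simp only: Crrp_def Crrp_of_def vec_lambda_beta q)
  qed
  show ?thesis
    using MRC_mean_trace[OF \<open>prob_space Mw\<close> _ herm] Y \<open>invertible Crp\<close> part2 part3
    unfolding Crp_def Crrp_def by (auto simp: cgauss_def)
qed

end
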